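(* Let $P\subset\mathbb{R}^n$ be a convex polytope of dimension $n$ containing the origin in its interior. Then $$\lim_{R\to\infty}\frac{\omega_n}{R^n}\operatorname{Vol}_P\big(B_P(R)\big)=\frac{|\operatorname{Flags}(P)|}{(n!)^2}.$$
   Context: For a convex body $K\subset\mathbb{R}^n$ (compact, convex, nonempty interior) and $x\in\operatorname{int}K$, let $K^x:=(K-x)^\circ=\{\xi:\langle\xi,y-x\rangle\le 1\ \text{for all } y\in K\}$ be the polar of $K$ with respect to $x$. The forward Funk metric ball of radius $R>0$ centered at $x\in \operatorname{int}K$ is $B_K(x,R):=x+(1-e^{-R})(K-x)$, and $B_K(R):=B_K(0,R)$. The Holmes--Thompson volume of the Funk geometry on $K$ is $\operatorname{Vol}_K(U):=\frac{1}{\omega_n}\int_U|K^x|\,dx$ for Borel $U\subset \operatorname{int}K$, where $|\cdot|$ is Lebesgue measure and $\omega_n$ is the volume of the Euclidean unit ball in $\mathbb{R}^n$. A flag of an $n$-dimensional polytope $P$ is a sequence $f=(f_0,\dots,f_n)$ of faces of $P$ with $\dim f_i=i$ and $f_i\subset f_{i+1}$ (so $f_n=P$). $\operatorname{Flags}(P)$ denotes the set of flags of $P$. *)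

theory Defs
  imports "HOL-Analysis.Analysis"
begin

definition polar_at :: "'a::euclidean_space set \<Rightarrow> 'a \<Rightarrow> 'a set" where
  "polar_at K x = {\<xi>. \<forall>y\<in>K. \<xi> \<bullet> (y - x) \<le> 1}"

definition funk_ball :: "'a::euclidean_space set \<Rightarrow> 'a \<Rightarrow> real \<Rightarrow> 'a set" where
  "funk_ball K x R = (\<lambda>y. x + (1 - exp (- R)) *\<^sub>R (y - x)) ` K"

text \<open>
  The volume is extended-valued, since it can be infinite on Borel subsets of the interior
  of \<open>K\<close>. It is only meaningful for Borel sets \<open>U \<subseteq> interior K\<close>.
\<close>
definition holmes_thompson_vol :: "'a::euclidean_space set \<Rightarrow> 'a set \<Rightarrow> ennreal" where
  "holmes_thompson_vol K U =
     ennreal (1 / unit_ball_vol (real DIM('a))) *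
     (\<integral>\<^sup>+x\<in>U. emeasure lborel (polar_at K x) \<partial>lborel)"

text \<open>
  A flag \<open>(f\<^sub>0, \<dots>, f\<^sub>n)\<close> of an \<open>n\<close>-dimensional polytope is a list of length \<open>n + 1\<close>. Although
  \<^const>\<open>face_of\<close> admits the empty face, it cannot occur, as its dimension is \<open>-1\<close>. The last
  entry is necessarily \<open>P\<close>, the only face of full dimension.
\<close>
definition flags :: "'a::euclidean_space set \<Rightarrow> 'a set list set" where
  "flags P = {fs. int (length fs) = aff_dim P + 1 \<and>
                  (\<forall>i<length fs. fs ! i face_of P \<and> aff_dim (fs ! i) = int i) \<and>
                  (\<forall>i. Suc i < length fs \<longrightarrow> fs ! i \<subseteq> fs ! Suc i)}"

lemma finite_flags:
  assumes "polytope P"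
  shows "finite (flags P)"
proof (rule finite_subset)
  show "flags P \<subseteq> {fs. set fs \<subseteq> {F. F face_of P} \<and> length fs = nat (aff_dim P + 1)}"
    by (auto simp: flags_def in_set_conv_nth)
  show "finite {fs. set fs \<subseteq> {F. F face_of P} \<and> length fs = nat (aff_dim P + 1)}"
    using finite_polytope_faces[OF assms] by (rule finite_lists_length_eq)
qed

lemma last_flag:
  assumes "polytope P" "fs \<in> flags P" "fs \<noteq> []"
  shows "last fs = P"
proof -
  have *: "last fs face_of P" "aff_dim (last fs) = aff_dim P"
    using assms(2,3) by (auto simp: flags_def last_conv_nth of_nat_diff Suc_leI)
  show ?thesis
    using face_of_aff_dim_lt[OF polytope_imp_convex[OF assms(1)] *(1)] *(2) by auto
qed

end

theory Submission
  imports Defs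
begin

text \<open>
  Write \<open>n\<close> for the dimension and \<open>\<epsilon> = exp (- R)\<close>, so that the ball is \<open>(1 - \<epsilon>) P\<close>. After the factor
  \<open>\<omega>\<^sub>n\<close> has cancelled, the quantity of interest is \<open>R\<^sup>-\<^sup>n\<close> times the integral of the polar volume
  \<open>|P\<^sup>x|\<close> over the ball. The barycentric subdivision cuts this integral into one piece for each flag,
  and every piece turns out to tend to \<open>1 / (n!)\<^sup>2\<close>.
  
  Choose a point in the relative interior of every face, the origin for \<open>P\<close> itself. A flag gives
  points \<open>p\<^sub>0, \<dots>, p\<^sub>n\<close> with \<open>p\<^sub>n = 0\<close>, and the simplices spanned by these points, one for each flag,
  cover \<open>P\<close> (\<open>flag_simplices_cover\<close>) and overlap only in their boundaries (\<open>flag_simplices_disjoint\<close>).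
  Because \<open>p\<^sub>n = 0\<close>, the ball cuts out of each simplex the points whose barycentric weight at \<open>p\<^sub>n\<close> is at
  least \<open>\<epsilon>\<close>.
  
  Fix a flag and use the edges \<open>b\<^sub>i = p\<^sub>i\<^sub>+\<^sub>1 - p\<^sub>i\<close> as a basis: the simplex consists of the points
  \<open>x = p\<^sub>0 + \<Sum>\<^sub>i s\<^sub>i b\<^sub>i\<close> with \<open>1 \<ge> s\<^sub>0 \<ge> \<dots> \<ge> s\<^sub>n\<^sub>-\<^sub>1 \<ge> 0\<close>, and the truncation reads \<open>s\<^sub>n\<^sub>-\<^sub>1 \<ge> \<epsilon>\<close>. Describe a
  point \<open>\<xi>\<close> of \<open>P\<^sup>x\<close> by the numbers \<open>\<eta>\<^sub>i = - s\<^sub>i \<langle>\<xi>, b\<^sub>i\<rangle>\<close>, and let \<open>Q\<^sub>s\<close> be the set of all these \<open>\<eta>\<close>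
  (\<open>dual_body\<close>). The volume of \<open>Q\<^sub>s\<close> is \<open>|P\<^sup>x| \<Prod>\<^sub>i s\<^sub>i\<close> up to the determinant of the edge basis, and
  that determinant is also the Jacobian of the chart \<open>s \<mapsto> x\<close>, so the two cancel. The integral over the
  truncated simplex is therefore the integral of \<open>|Q\<^sub>s|\<close> against \<open>\<Prod>\<^sub>i ds\<^sub>i / s\<^sub>i\<close>. The substitution
  \<open>s\<^sub>i = exp (- R t\<^sub>i)\<close> turns \<open>R\<^sup>-\<^sup>n\<close> times it into the integral of \<open>|Q\<^sub>s|\<close> over the simplex
  \<open>0 \<le> t\<^sub>0 \<le> \<dots> \<le> t\<^sub>n\<^sub>-\<^sub>1 \<le> 1\<close>, which does not depend on \<open>R\<close> and has volume \<open>1 / n!\<close> (\<open>nn_integral_chart\<close>).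
  
  For a strictly increasing \<open>t\<close> the ratios \<open>s\<^sub>i / s\<^sub>j\<close> with \<open>j < i\<close> tend to \<open>0\<close>, and then \<open>Q\<^sub>s\<close> converges to
  the standard simplex \<open>\<eta> \<ge> 0\<close>, \<open>\<Sum>\<^sub>i \<eta>\<^sub>i \<le> 1\<close>, whose volume is again \<open>1 / n!\<close>. The inclusion of the limit
  in the simplex only tests \<open>\<xi>\<close> against points of the flag simplex (\<open>dual_body_sum\<close>, \<open>dual_body_upper\<close>).
  The opposite inclusion uses the supporting hyperplanes of the faces of the flag, whose functionals are
  triangular with respect to the edges (\<open>dual_body_lower\<close>). All the sets \<open>Q\<^sub>s\<close> lie in one bounded set
  because \<open>p\<^sub>k\<close> is in the relative interior of its face (\<open>dual_body_bounded\<close>). Dominated convergence, once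
  in \<open>\<eta>\<close> and once in \<open>t\<close>, gives \<open>1 / n! \<cdot> 1 / n!\<close>.
\<close>

section \<open>Lebesgue measure in linear and exponential coordinates\<close>

text \<open>
  The edges of a flag come in a definite order, and the triangular structure behind the whole argument
  refers to it. Coordinates along a flag are therefore indexed by an ordered type with \<open>DIM('a)\<close> elements,
  a copy of \<open>{0, \<dots>, n - 1}\<close>; an arbitrary finite index type carries no order.
\<close>

typedef (overloaded) ('a::euclidean_space) coord = "{..<DIM('a)}"
  by (rule exI[of _ 0]) simp

lemma bij_betw_Rep_coord: "bij_betw Rep_coord (UNIV :: 'a::euclidean_space coord set) {..<DIM('a)}"
  using Rep_coord by (intro bij_betwI') (auto simp: Rep_coord_inject intro: Rep_coord_cases[OF iffD2[OF lessThan_iff]])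

instance coord :: (euclidean_space) finite
  by standard (use bij_betw_Rep_coord bij_betw_finite in blast)

instantiation coord :: (euclidean_space) wellorder
begin
definition "i \<le> j \<longleftrightarrow> Rep_coord i \<le> Rep_coord j"
definition "i < j \<longleftrightarrow> Rep_coord i < Rep_coord j"
instance
proof
  fix P :: "'a coord \<Rightarrow> bool" and a :: "'a coord"
  assume *: "\<And>x. (\<And>y. y < x \<Longrightarrow> P y) \<Longrightarrow> P x"
  show "P a"
    by (induction a rule: measure_induct_rule[of Rep_coord]) (rule *, simp add: less_coord_def)
qed (auto simp: less_eq_coord_def less_coord_def Rep_coord_inject)
end

lemma CARD_coord: "CARD('a::euclidean_space coord) = DIM('a)"
  using bij_betw_same_card[OF bij_betw_Rep_coord] by simp

lemma sum_coord:
  fixes g :: "nat \<Rightarrow> 'b::comm_monoid_add"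
  shows "(\<Sum>i\<in>(UNIV :: 'a::euclidean_space coord set). g (Rep_coord i)) = (\<Sum>k<DIM('a). g k)"
  using sum.reindex_bij_betw[OF bij_betw_Rep_coord] .

lemma emeasure_linear_vimage:
  fixes U :: "real^'m::{finite,wellorder} \<Rightarrow> real^'m::_"
  assumes "linear U" "inj U" "A \<in> sets borel"
  shows "emeasure lborel A = ennreal \<bar>det (matrix U)\<bar> * emeasure lborel (U -` A)"
proof -
  have surj: "surj U" using assms linear_injective_imp_surjective by blast
  have cont: "continuous_on UNIV U" using assms(1) by (simp add: linear_continuous_on linear_conv_bounded_linear)
  have [measurable]: "U \<in> borel \<rightarrow>\<^sub>M borel" using cont by (rule borel_measurable_continuous_onI)
  obtain V where V: "linear V" "\<And>x. V (U x) = x" "\<And>x. U (V x) = x"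
    using linear_injective_isomorphism[OF assms(1,2)] by blast
  have "lborel = density (distr lborel borel U) (\<lambda>_. ennreal \<bar>det (matrix U)\<bar>)" (is "_ = ?M")
  proof (rule lborel_eqI)
    fix l u :: "(real,'m) vec" assume lu: "\<And>b. b \<in> Basis \<Longrightarrow> l \<bullet> b \<le> u \<bullet> b"
    let ?B = "U -` box l u"
    have op: "open ?B" using cont open_box by (rule open_vimage[rotated])
    have B: "?B = V ` box l u" using V(2,3) by (auto intro: rev_image_eqI[of "U _"] simp del: mem_box)
    have bd: "bounded ?B" unfolding B using V(1) by (intro bounded_linear_image) (auto simp: linear_conv_bounded_linear)
    have lm: "?B \<in> lmeasurable" using op bd by (simp add: lmeasurable_open)
    have im: "U ` ?B = box l u" using surj by auto
    have fin: "emeasure lborel ?B < \<infinity>" using bd emeasure_bounded_finite by blast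
    have "measure lebesgue (box l u) = \<bar>det (matrix U)\<bar> * measure lebesgue ?B"
      using measure_linear_image[OF assms(1) lm] im by simp
    then have eq: "measure lborel (box l u) = \<bar>det (matrix U)\<bar> * measure lborel ?B"
      using op by (simp add: measure_completion)
    have "emeasure ?M (box l u) = ennreal \<bar>det (matrix U)\<bar> * emeasure lborel ?B"
      by (simp add: emeasure_density nn_integral_cmult_indicator emeasure_distr)
    also have "\<dots> = ennreal (measure lborel (box l u))"
      using fin by (simp add: eq ennreal_mult emeasure_eq_ennreal_measure less_top)
    finally show "emeasure ?M (box l u) = (\<Prod>b\<in>Basis. (u - l) \<bullet> b)"
      using lu by (simp add: measure_lborel_box_eq)
  qed simp
  then have "emeasure lborel A = emeasure ?M A" by simp
  also have "\<dots> = ennreal \<bar>det (matrix U)\<bar> * emeasure lborel (U -` A)"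
    using assms(3) by (simp add: emeasure_density nn_integral_cmult_indicator emeasure_distr)
  finally show ?thesis .
qed

text \<open>
  After an orthonormal identification of the two spaces, \<open>L\<close> becomes a square matrix, and a matrix and its
  transpose have the same determinant. This equality is what makes the Jacobian of a chart cancel
  against that of the dual coordinates.
\<close>

lemma linear_scaling_adjoint:
  fixes L :: "real^'m::{finite,wellorder} \<Rightarrow> 'a::euclidean_space"
  assumes L: "linear L" "inj L" and dim: "CARD('m) = DIM('a)"
  obtains c where "c > 0"
    and "\<And>f. f \<in> borel_measurable borel \<Longrightarrow> (\<integral>\<^sup>+x. f x \<partial>lborel) = ennreal c * (\<integral>\<^sup>+s. f (L s) \<partial>lborel)"
    and "\<And>A. A \<in> sets borel \<Longrightarrow> emeasure lborel A = ennreal c * emeasure lborel (adjoint L -` A)"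
proof -
  obtain e :: "'m \<Rightarrow> 'a" where e: "bij_betw e UNIV Basis"
    using dim by (metis finite_same_card_bij finite finite_Basis)
  have eB: "e i \<in> Basis" for i using e by (auto dest: bij_betwE)
  have ee: "e i \<bullet> e j = (if i = j then 1 else 0)" for i j
    using e eB by (auto simp: inner_Basis bij_betw_def inj_on_def)
  define \<psi> where "\<psi> = (\<lambda>s::(real,'m) vec. \<Sum>i\<in>UNIV. s $ i *\<^sub>R e i)"
  define \<phi> where "\<phi> = (\<lambda>x. \<chi> i. x \<bullet> e i)"
  have lin: "linear \<psi>" "linear \<phi>"
    by (auto simp: \<psi>_def \<phi>_def intro!: linearI simp: scaleR_left_distrib sum.distrib scaleR_sum_right vec_eq_iff inner_left_distrib)
  have comp: "\<psi> s \<bullet> e i = s $ i" for s i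
    by (simp add: \<psi>_def inner_sum_left ee if_distrib cong: if_cong)
  have \<phi>\<psi>: "\<phi> (\<psi> s) = s" for s by (simp add: \<phi>_def comp)
  have \<psi>\<phi>: "\<psi> (\<phi> x) = x" for x
  proof -
    have "\<psi> (\<phi> x) = (\<Sum>i\<in>UNIV. (\<lambda>b. (x \<bullet> b) *\<^sub>R b) (e i))" by (simp add: \<psi>_def \<phi>_def)
    also have "\<dots> = (\<Sum>b\<in>Basis. (x \<bullet> b) *\<^sub>R b)" by (rule sum.reindex_bij_betw[OF e])
    finally show ?thesis by (simp add: euclidean_representation)
  qed
  have adj: "\<phi> x \<bullet> s = x \<bullet> \<psi> s" for x s
    by (simp add: \<phi>_def \<psi>_def inner_vec_def inner_sum_right mult.commute)
  have meas: "f \<in> borel \<rightarrow>\<^sub>M borel" if "linear f" for f :: "'x::euclidean_space \<Rightarrow> 'y::euclidean_space"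
    using that by (intro borel_measurable_continuous_onI) (simp add: linear_continuous_on linear_conv_bounded_linear)
  note [measurable] = meas[OF lin(1)] meas[OF lin(2)] meas[OF L(1)]
  have lb: "lborel = distr lborel borel \<psi>"
  proof (rule lborel_eqI)
    fix l u :: 'a assume lu: "\<And>b. b \<in> Basis \<Longrightarrow> l \<bullet> b \<le> u \<bullet> b"
    have "\<psi> -` box l u = box (\<phi> l) (\<phi> u)"
    proof -
      have "(\<forall>b\<in>Basis. l \<bullet> b < x \<bullet> b \<and> x \<bullet> b < u \<bullet> b) \<longleftrightarrow> (\<forall>i. l \<bullet> e i < x \<bullet> e i \<and> x \<bullet> e i < u \<bullet> e i)" for x
        using e by (force simp: bij_betw_def)
      then show ?thesis by (auto simp: box_def mem_box_cart comp \<phi>_def inner_axis Basis_vec_def)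
    qed
    then have "emeasure (distr lborel borel \<psi>) (box l u) = emeasure lborel (box (\<phi> l) (\<phi> u))"
      by (simp add: emeasure_distr)
    also have "\<dots> = ennreal (\<Prod>b\<in>Basis. (\<phi> u - \<phi> l) \<bullet> b)"
      using lu eB by (subst emeasure_lborel_box) (auto simp: Basis_vec_def inner_axis \<phi>_def)
    also have "(\<Prod>b\<in>Basis. (\<phi> u - \<phi> l) \<bullet> b) = (\<Prod>i\<in>UNIV. (\<phi> u - \<phi> l) $ i)"
      by (subst prod.reindex_bij_betw[of "\<lambda>i. axis i 1" UNIV Basis, symmetric])
         (auto simp: bij_betw_def inj_on_def axis_eq_axis Basis_vec_def inner_axis)
    also have "\<dots> = (\<Prod>i\<in>UNIV. (\<lambda>b. (u - l) \<bullet> b) (e i))" by (simp add: \<phi>_def inner_diff_left)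
    also have "\<dots> = (\<Prod>b\<in>Basis. (u - l) \<bullet> b)" by (rule prod.reindex_bij_betw[OF e])
    finally show "emeasure (distr lborel borel \<psi>) (box l u) = (\<Prod>b\<in>Basis. (u - l) \<bullet> b)" .
  qed simp
  have em\<psi>: "emeasure lborel A = emeasure lborel (\<psi> -` A)" if "A \<in> sets borel" for A
    by (subst lb) (use that in \<open>simp add: emeasure_distr\<close>)
  have em\<phi>: "emeasure lborel A = emeasure lborel (\<phi> -` A)" if "A \<in> sets borel" for A
  proof -
    have "\<phi> -` A \<in> sets borel" using that measurable_sets_borel[OF meas[OF lin(2)] that] by simp
    from em\<psi>[OF this] show ?thesis by (simp add: vimage_def \<phi>\<psi>)
  qed
  define U where "U = \<phi> \<circ> L"
  have U: "linear U" "inj U"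
    using linear_compose[OF L(1) lin(2)] inj_compose[OF inj_on_inverseI[of _ \<psi>] L(2)] \<psi>\<phi>
    by (auto simp: U_def)
  have LU: "L = \<psi> \<circ> U" by (auto simp: U_def \<psi>\<phi>)
  define c where "c = \<bar>det (matrix U)\<bar>"
  have "det (matrix U) \<noteq> 0"
    using U by (metis det_nz_iff_inj)
  then have c: "c > 0" by (simp add: c_def)
  have adjL: "adjoint L = adjoint U \<circ> \<phi>"
  proof (rule adjoint_unique[symmetric, THEN sym])
    show "\<forall>x y. L x \<bullet> y = x \<bullet> (adjoint U \<circ> \<phi>) y"
      using adj by (simp add: LU adjoint_works[OF U(1)] inner_commute)
  qed
  have adjU: "adjoint U = (\<lambda>x. transpose (matrix U) *v x)"
    using adjoint_matrix[of "matrix U"] U(1) by simp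
  have matadj: "matrix (adjoint U) = transpose (matrix U)" unfolding adjU by simp
  have injadj: "inj (adjoint U)"
    using \<open>det (matrix U) \<noteq> 0\<close> by (metis adjoint_linear U(1) det_nz_iff_inj det_transpose matadj)
  have em1: "emeasure lborel A = ennreal c * emeasure lborel (L -` A)" if "A \<in> sets borel" for A
  proof -
    have B: "\<psi> -` A \<in> sets borel" using measurable_sets_borel[OF meas[OF lin(1)] that] by simp
    show ?thesis unfolding em\<psi>[OF that] emeasure_linear_vimage[OF U B] c_def LU by (simp add: vimage_comp)
  qed
  have em2: "emeasure lborel A = ennreal c * emeasure lborel (adjoint L -` A)" if "A \<in> sets borel" for A
  proof -
    have B: "adjoint U -` A \<in> sets borel" using measurable_sets_borel[OF meas[OF adjoint_linear[OF U(1)]] that] by simp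
    show ?thesis
      unfolding emeasure_linear_vimage[OF adjoint_linear[OF U(1)] injadj that] em\<phi>[OF B] c_def adjL matadj
      by (simp add: vimage_comp)
  qed
  have "lborel = density (distr lborel borel L) (\<lambda>_. ennreal c)"
    by (rule measure_eqI) (auto simp: em1 emeasure_density nn_integral_cmult_indicator emeasure_distr)
  note lL = this
  have "(\<integral>\<^sup>+x. f x \<partial>lborel) = ennreal c * (\<integral>\<^sup>+s. f (L s) \<partial>lborel)"
    if [measurable]: "f \<in> borel_measurable borel" for f
  proof -
    have "(\<integral>\<^sup>+x. f x \<partial>lborel) = (\<integral>\<^sup>+x. f x \<partial>density (distr lborel borel L) (\<lambda>_. ennreal c))"
      using lL by simp
    also have "\<dots> = (\<integral>\<^sup>+s. ennreal c * f (L s) \<partial>lborel)"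
      by (subst nn_integral_density) (auto simp: nn_integral_distr)
    also have "\<dots> = ennreal c * (\<integral>\<^sup>+s. f (L s) \<partial>lborel)" by (rule nn_integral_cmult) simp
    finally show ?thesis .
  qed
  with c em2 show thesis using that by blast
qed

lemma bij_betw_axis: "bij_betw (\<lambda>i::'m::finite. axis i 1 :: real^'m) UNIV Basis"
  by (auto simp: bij_betw_def inj_on_def axis_eq_axis Basis_vec_def)

lemma borel_measurable_vec_lambda [measurable (raw)]:
  fixes f :: "'m::finite \<Rightarrow> 'b \<Rightarrow> real"
  assumes "\<And>i. f i \<in> borel_measurable M"
  shows "(\<lambda>x. \<chi> i. f i x) \<in> borel_measurable M"
  by (subst borel_measurable_euclidean_space) (use assms in \<open>auto simp: Basis_vec_def inner_axis\<close>)

lemma nn_integral_inverse_Ioo: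
  fixes a b R :: real
  assumes "R > 0" "0 < a" "a \<le> b"
  shows "(\<integral>\<^sup>+x. ennreal (1 / (R * x)) * indicator {a<..<b} x \<partial>lborel) = ennreal ((ln b - ln a) / R)"
proof -
  have "(\<integral>\<^sup>+x. ennreal (1 / (R * x)) * indicator {a<..<b} x \<partial>lborel)
      = (\<integral>\<^sup>+x. ennreal (1 / (R * x)) * indicator {a..b} x \<partial>lborel)"
  proof (rule nn_integral_cong_AE)
    have "AE x in lborel. x \<noteq> a" "AE x in lborel. x \<noteq> b" by (rule AE_lborel_singleton)+
    then show "AE x in lborel. ennreal (1 / (R * x)) * indicator {a<..<b} x = ennreal (1 / (R * x)) * indicator {a..b} x"
      by eventually_elim (auto simp: indicator_def)
  qed
  also have "\<dots> = ennreal (ln b / R - ln a / R)"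
    using assms by (intro nn_integral_FTC_Icc)
      (auto intro!: derivative_eq_intros simp: field_simps)
  finally show ?thesis by (simp add: diff_divide_distrib)
qed

text \<open>
  The measure \<open>\<Prod>\<^sub>i ds\<^sub>i / (R s\<^sub>i)\<close> on the positive orthant becomes Lebesgue measure under
  \<open>s \<mapsto> - ln s / R\<close>. It suffices to compare the two on boxes, where both sides are products of
  one-dimensional integrals.
\<close>

lemma nn_integral_exp_coords:
  fixes f :: "real^'m \<Rightarrow> ennreal"
  assumes R: "R > 0" and f[measurable]: "f \<in> borel_measurable borel"
  shows "(\<integral>\<^sup>+t. f (\<chi> i. exp (- R * t $ i)) \<partial>lborel)
       = (\<integral>\<^sup>+s. f s * indicator {s. \<forall>i. 0 < s $ i} s * (\<Prod>i\<in>UNIV. ennreal (1 / (R * s $ i))) \<partial>lborel)"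
proof -
  define lg where "lg = (\<lambda>s::real^'m. \<chi> i. - (ln (s $ i) / R))"
  have [measurable]: "lg \<in> borel \<rightarrow>\<^sub>M borel"
    unfolding lg_def by measurable
  define w where "w = (\<lambda>s::real^'m. \<Prod>i\<in>UNIV. ennreal (1 / (R * s $ i)) * indicator {0<..} (s $ i))"
  have [measurable]: "w \<in> borel_measurable borel" unfolding w_def by measurable
  have "lborel = distr (density lborel w) borel lg" (is "_ = ?M")
  proof (rule lborel_eqI)
    fix l u :: "real^'m" assume "\<And>b. b \<in> Basis \<Longrightarrow> l \<bullet> b \<le> u \<bullet> b"
    then have lu: "l $ i \<le> u $ i" for i by (metis bij_betw_axis bij_betwE cart_eq_inner_axis UNIV_I)
    let ?h = "\<lambda>i x. ennreal (1 / (R * x)) * indicator {exp (- R * u $ i)<..<exp (- R * l $ i)} x"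
    have "emeasure ?M (box l u) = (\<integral>\<^sup>+s. w s * indicator (lg -` box l u) s \<partial>lborel)"
      by (subst emeasure_distr) (simp_all add: emeasure_density measurable_sets_borel[where M=borel])
    also have "\<dots> = (\<integral>\<^sup>+s. (\<Prod>i\<in>UNIV. ?h i (s $ i)) \<partial>lborel)"
    proof (rule nn_integral_cong)
      fix s :: "real^'m"
      have *: "(l $ i < - (ln x / R) \<and> - (ln x / R) < u $ i) \<longleftrightarrow> exp (- R * u $ i) < x \<and> x < exp (- R * l $ i)"
        if "x > 0" for x i
      proof -
        have "exp (- R * u $ i) < x \<longleftrightarrow> - R * u $ i < ln x" "x < exp (- R * l $ i) \<longleftrightarrow> ln x < - R * l $ i"
          using that by (metis exp_less_cancel_iff exp_ln)+
        then show ?thesis using R by (auto simp: field_simps)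
      qed
      show "w s * indicator (lg -` box l u) s = (\<Prod>i\<in>UNIV. ?h i (s $ i))"
      proof (cases "\<forall>i. s $ i > 0")
        case True
        have "indicator (lg -` box l u) s = (\<Prod>i\<in>UNIV. indicator {exp (- R * u $ i)<..<exp (- R * l $ i)} (s $ i) :: ennreal)"
          using * True by (auto simp: indicator_def mem_box_cart lg_def)
        then show ?thesis using True by (simp add: w_def prod.distrib)
      next
        case False
        then obtain i where i: "s $ i \<le> 0" by (auto simp: not_less)
        have n: "\<not> exp (- R * u $ i) < s $ i" using i by (smt (verit) exp_gt_zero)
        have "w s = 0" unfolding w_def using i by (intro prod_zero) (auto intro!: exI[of _ i])
        moreover have "(\<Prod>i\<in>UNIV. ?h i (s $ i)) = 0"
          using n by (intro prod_zero) (auto intro!: exI[of _ i] simp: indicator_def)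
        ultimately show ?thesis by simp
      qed
    qed
    also have "\<dots> = (\<integral>\<^sup>+(s::real^'m). (\<Prod>b\<in>Basis. ?h (THE i. b = axis i 1) (s \<bullet> b)) \<partial>lborel)"
      by (subst prod.reindex_bij_betw[OF bij_betw_axis, symmetric]) (simp add: axis_eq_axis inner_axis)
    also have "\<dots> = (\<Prod>b\<in>(Basis :: (real^'m) set). \<integral>\<^sup>+x. ?h (THE i. b = axis i 1) x \<partial>lborel)"
      by (rule nn_integral_lborel_prod) auto
    also have "\<dots> = (\<Prod>b\<in>Basis. ennreal ((u - l) \<bullet> b))"
    proof (rule prod.cong)
      fix b :: "real^'m" assume "b \<in> Basis"
      then obtain i where b: "b = axis i 1" by (auto simp: Basis_vec_def)
      show "(\<integral>\<^sup>+x. ?h (THE i. b = axis i 1) x \<partial>lborel) = ennreal ((u - l) \<bullet> b)"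
        using R lu[of i] by (subst nn_integral_inverse_Ioo) (auto simp: b axis_eq_axis inner_axis field_simps)
    qed simp
    also have "\<dots> = (\<Prod>b\<in>Basis. (u - l) \<bullet> b)"
      using lu by (subst prod_ennreal) (auto simp: Basis_vec_def inner_axis)
    finally show "emeasure ?M (box l u) = (\<Prod>b\<in>Basis. (u - l) \<bullet> b)" .
  qed simp
  have [measurable]: "(\<lambda>t::real^'m. \<chi> i. exp (- R * t $ i)) \<in> borel \<rightarrow>\<^sub>M borel"
    by measurable
  have "(\<integral>\<^sup>+t. f (\<chi> i. exp (- R * t $ i)) \<partial>lborel) = (\<integral>\<^sup>+t. f (\<chi> i. exp (- R * t $ i)) \<partial>?M)"
    using \<open>lborel = ?M\<close> by simp
  also have "\<dots> = (\<integral>\<^sup>+s. w s * f (\<chi> i. exp (- R * lg s $ i)) \<partial>lborel)"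
  proof -
    have F: "(\<lambda>t::real^'m. f (\<chi> i. exp (- R * t $ i))) \<in> borel_measurable borel" by measurable
    have "(\<lambda>s. f (\<chi> i. exp (- R * lg s $ i))) \<in> borel_measurable borel"
      using measurable_compose[OF \<open>lg \<in> borel \<rightarrow>\<^sub>M borel\<close> F] .
    then show ?thesis
      using F by (subst nn_integral_distr) (simp_all add: nn_integral_density)
  qed
  also have "\<dots> = (\<integral>\<^sup>+s. f s * indicator {s. \<forall>i. 0 < s $ i} s * (\<Prod>i\<in>UNIV. ennreal (1 / (R * s $ i))) \<partial>lborel)"
  proof (rule nn_integral_cong)
    fix s :: "real^'m"
    show "w s * f (\<chi> i. exp (- R * lg s $ i)) = f s * indicator {s. \<forall>i. 0 < s $ i} s * (\<Prod>i\<in>UNIV. ennreal (1 / (R * s $ i)))"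
    proof (cases "\<forall>i. s $ i > 0")
      case True
      then have "(\<chi> i. exp (- R * lg s $ i)) = s" using R by (simp add: lg_def vec_eq_iff)
      with True show ?thesis by (simp add: w_def mult.commute)
    next
      case False
      then obtain i where "\<not> 0 < s $ i" by auto
      then have "w s = 0" unfolding w_def by (intro prod_zero) (auto intro!: exI[of _ i])
      with False show ?thesis by simp
    qed
  qed
  finally show ?thesis .
qed

lemma std_simplex_vec:
  "convex hull (insert 0 Basis) = {x :: real^'m. (\<forall>i. 0 \<le> x $ i) \<and> (\<Sum>i\<in>UNIV. x $ i) \<le> 1}"
  unfolding std_simplex
  by (subst sum.reindex_bij_betw[OF bij_betw_axis, symmetric]) (auto simp: inner_axis Basis_vec_def)

lemma emeasure_std_simplex_vec:
  "emeasure lborel {x :: real^'m. (\<forall>i. 0 \<le> x $ i) \<and> (\<Sum>i\<in>UNIV. x $ i) \<le> 1} = ennreal (1 / fact CARD('m))"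
  using emeasure_std_simplex[where 'a="real^'m"] by (simp add: std_simplex_vec)

definition increasing_simplex :: "(real^'m::{finite,wellorder}) set" where
  "increasing_simplex = {t. (\<forall>i. 0 \<le> t $ i \<and> t $ i \<le> 1) \<and> (\<forall>i j. i \<le> j \<longrightarrow> t $ i \<le> t $ j)}"

definition decreasing_simplex :: "(real^'m::{finite,wellorder}) set" where
  "decreasing_simplex = {s. (\<forall>i. 0 \<le> s $ i \<and> s $ i \<le> 1) \<and> (\<forall>i j. i \<le> j \<longrightarrow> s $ j \<le> s $ i)}"

text \<open>
  Partial summation \<open>x \<mapsto> (x\<^sub>0, x\<^sub>0 + x\<^sub>1, \<dots>)\<close> has a triangular matrix with unit diagonal and maps the
  standard simplex onto the increasing one.
\<close>

lemma emeasure_increasing_simplex: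
  "emeasure lborel (increasing_simplex :: (real^'m::{finite,wellorder}) set) = ennreal (1 / fact CARD('m))"
  (is "emeasure _ ?T = _")
proof -
  define S where "S = convex hull (insert 0 Basis :: (real,'m) vec set)"
  define A :: "(real,'m) vec \<Rightarrow> (real,'m) vec" where "A = (\<lambda>x. \<chi> i. \<Sum>j\<in>{..i}. x $ j)"
  have lin: "linear A"
    by (auto simp: A_def vec_eq_iff sum.distrib sum_distrib_left intro!: linearI)
  have S: "S = {x. (\<forall>i. 0 \<le> x $ i) \<and> (\<Sum>i\<in>UNIV. x $ i) \<le> 1}"
    unfolding S_def by (rule std_simplex_vec)
  have cpt: "compact S" unfolding S_def by (intro finite_imp_compact_convex_hull) auto
  have "matrix A $ i $ j = (if j \<le> i then 1 else 0)" for i j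
    by (simp add: matrix_def A_def axis_def if_distrib cong: if_cong)
  then have det: "det (matrix A) = 1" by (subst det_lowerdiagonal) auto
  then have "surj A" using lin by (metis det_nz_iff_inj linear_injective_imp_surjective zero_neq_one)
  have img: "A ` S = ?T"
    unfolding increasing_simplex_def
  proof safe
    fix x assume "x \<in> S"
    then have x: "0 \<le> x $ i" "(\<Sum>i\<in>UNIV. x $ i) \<le> 1" for i by (auto simp: S)
    show "0 \<le> A x $ i" "i \<le> j \<Longrightarrow> A x $ i \<le> A x $ j" for i j
      using x by (auto simp: A_def intro!: sum_nonneg sum_mono2)
    show "A x $ i \<le> 1" for i
      using x sum_mono2[of UNIV "{..i}" "\<lambda>i. x $ i"] by (force simp: A_def)
  next
    fix t :: "(real,'m) vec" assume t: "\<forall>i. 0 \<le> t $ i \<and> t $ i \<le> 1" "\<forall>i j. i \<le> j \<longrightarrow> t $ i \<le> t $ j"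
    obtain x where x: "t = A x" using \<open>surj A\<close> by (metis surjD)
    have "0 \<le> x $ i" for i
    proof (cases "{..<i} = {}")
      case True
      then have "{..i} = {i}" by (auto simp: le_less)
      then have "t $ i = x $ i" by (simp add: x A_def)
      then show ?thesis using t by metis
    next
      case False
      \<comment> \<open>The predecessor of \<open>i\<close>: consecutive coordinates of \<open>t\<close> differ by \<open>x $ i\<close>.\<close>
      define j where "j = Max {..<i}"
      have "j < i" using False Max_in[of "{..<i}"] by (simp add: j_def)
      have "{..<i} = {..j}" using \<open>j < i\<close> by (auto simp: j_def)
      then have "t $ i = t $ j + x $ i" by (simp add: x A_def ivl_disj_un_singleton(2)[symmetric])
      then show ?thesis using t(2) \<open>j < i\<close> by (metis add.commute le_add_same_cancel2 less_imp_le)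
    qed
    moreover have "(\<Sum>i\<in>UNIV. x $ i) = t $ (Max UNIV)"
    proof -
      have "{..Max UNIV} = (UNIV :: 'm set)" by (auto intro: Max_ge)
      then show ?thesis by (simp add: x A_def)
    qed
    ultimately show "t \<in> A ` S" using t x by (auto simp: S)
  qed
  have "compact (A ` S)" using cpt lin by (intro compact_continuous_image linear_continuous_on) (simp_all add: linear_conv_bounded_linear)
  then have cT: "compact ?T" by (simp add: img)
  have "measure lebesgue ?T = measure lebesgue S"
    using measure_lebesgue_linear_transformation[OF compact_imp_bounded[OF cpt] _ lin] cpt det img
    by (simp add: compact_imp_closed)
  then have "measure lborel ?T = measure lborel S"
    using cT cpt by (simp add: measure_completion compact_imp_closed)
  also have "\<dots> = 1 / fact CARD('m)" using content_std_simplex[where 'a="(real,'m) vec"] by (simp add: S_def)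
  finally show ?thesis
    using emeasure_eq_ennreal_measure[of lborel ?T] emeasure_compact_finite[OF cT] by simp
qed

lemma AE_lborel_hyperplane:
  fixes v :: "'a::euclidean_space"
  assumes "v \<noteq> 0"
  shows "AE x in lborel. v \<bullet> x \<noteq> 0"
proof -
  have "{x. v \<bullet> x = 0} \<in> null_sets lebesgue"
    using negligible_hyperplane[of v 0] assms by (simp add: negligible_iff_null_sets)
  then have "AE x in lebesgue. v \<bullet> x \<noteq> 0" by (auto dest: AE_not_in)
  then show ?thesis by (simp add: AE_completion_iff)
qed

lemma exp_in_decreasing_simplex:
  assumes "t \<in> increasing_simplex" "0 \<le> R"
  shows "(\<chi> i. exp (- R * t $ i)) \<in> decreasing_simplex"
  using assms by (auto simp: increasing_simplex_def decreasing_simplex_def mult_left_mono)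

text \<open>
  This separates the scales \<open>exp (- R t\<^sub>i)\<close>: for distinct exponents, each of them eventually exceeds any
  constant multiple of the smaller ones.
\<close>

lemma eventually_exp_dominated:
  fixes X :: "'b \<Rightarrow> real"
  assumes X: "filterlim X at_top F" and uv: "u < v"
  shows "\<forall>\<^sub>F k in F. B * exp (- X k * v) \<le> exp (- X k * u)"
proof -
  have "filterlim (\<lambda>k. (v - u) * X k) at_top F"
    using filterlim_tendsto_pos_mult_at_top[OF tendsto_const _ X] uv by simp
  then have "filterlim (\<lambda>k. exp ((v - u) * X k)) at_top F"
    using filterlim_compose[OF exp_at_top] by blast
  then have "\<forall>\<^sub>F k in F. B \<le> exp ((v - u) * X k)" by (simp add: filterlim_at_top)
  then show ?thesis
  proof eventually_elim
    case (elim k)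
    have "B * exp (- X k * v) \<le> exp ((v - u) * X k) * exp (- X k * v)" using elim by (intro mult_right_mono) auto
    also have "\<dots> = exp (- X k * u)" by (simp add: algebra_simps flip: exp_add)
    finally show ?case .
  qed
qed

section \<open>Flags and flag simplices\<close>

lemma flags_length:
  assumes "fs \<in> flags P" "aff_dim P = int d"
  shows "length fs = Suc d"
  using assms by (auto simp: flags_def)

lemma flags_mono:
  assumes "fs \<in> flags P" "i \<le> j" "j < length fs"
  shows "fs ! i \<subseteq> fs ! j"
  using assms(2,3)
proof (induction j rule: dec_induct)
  case (step j)
  then show ?case using assms(1) by (fastforce simp: flags_def)
qed simp

lemma flags_zero:
  assumes "polytope P" "aff_dim P = 0"
  shows "flags P = {[P]}"
proof -
  have "fs = [P]" if "fs \<in> flags P" for fs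
  proof -
    have "length fs = 1" using flags_length[OF that, of 0] assms by simp
    then obtain x where "fs = [x]" by (auto simp: length_Suc_conv)
    then show ?thesis using last_flag[OF assms(1) that] by simp
  qed
  moreover have "[P] \<in> flags P"
    using assms by (auto simp: flags_def polytope_imp_convex face_of_refl)
  ultimately show ?thesis by blast
qed

text \<open>
  Removing the last entry of a flag leaves a flag of a facet. The two results on flag simplices below are
  inductions along this equivalence.
\<close>

lemma flags_Suc:
  assumes P: "polytope P" and d: "aff_dim P = int (Suc d)"
  shows "fs \<in> flags P \<longleftrightarrow> (\<exists>G gs. fs = gs @ [P] \<and> G face_of P \<and> aff_dim G = int d \<and> gs \<in> flags G)"
proof
  assume fs: "fs \<in> flags P"
  have len: "length fs = Suc (Suc d)" using flags_length[OF fs d] .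
  define G where "G = fs ! d"
  have G: "G face_of P" "aff_dim G = int d" using fs len by (auto simp: flags_def G_def)
  have "fs = butlast fs @ [P]" using last_flag[OF P fs] len
    by (metis append_butlast_last_id list.size(3) old.nat.distinct(2))
  moreover have "butlast fs \<in> flags G"
  proof -
    have "fs ! i face_of G" if "i \<le> d" for i
    proof (rule face_of_subset)
      show "fs ! i face_of P" using fs that len by (auto simp: flags_def)
      show "fs ! i \<subseteq> G" unfolding G_def using flags_mono[OF fs that] len by simp
      show "G \<subseteq> P" using G face_of_imp_subset by blast
    qed
    then show ?thesis using fs len G by (auto simp: flags_def nth_butlast less_Suc_eq_le)
  qed
  ultimately show "\<exists>G gs. fs = gs @ [P] \<and> G face_of P \<and> aff_dim G = int d \<and> gs \<in> flags G"
    using G by blast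
next
  assume "\<exists>G gs. fs = gs @ [P] \<and> G face_of P \<and> aff_dim G = int d \<and> gs \<in> flags G"
  then obtain G gs where *: "fs = gs @ [P]" "G face_of P" "aff_dim G = int d" "gs \<in> flags G" by blast
  have len: "length gs = Suc d" using flags_length *(3,4) by blast
  have GP: "G \<subseteq> P" using face_of_imp_subset[OF *(2)] .
  have gs: "gs ! i face_of G" "aff_dim (gs ! i) = int i" if "i \<le> d" for i
    using *(4) that len by (auto simp: flags_def)
  have chain: "gs ! i \<subseteq> gs ! Suc i" if "i < d" for i
    using *(4) that len by (auto simp: flags_def)
  have nth: "fs ! i = (if i \<le> d then gs ! i else P)" if "i \<le> Suc d" for i
    using that len by (auto simp: *(1) nth_append)
  have "fs ! i face_of P \<and> aff_dim (fs ! i) = int i" if "i \<le> Suc d" for i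
  proof (cases "i = Suc d")
    case True
    then show ?thesis using nth[of i] d face_of_refl[OF polytope_imp_convex[OF P]] by simp
  next
    case False
    then show ?thesis using that nth[of i] gs[of i] face_of_trans[OF _ *(2), of "gs ! i"] by simp
  qed
  moreover have "fs ! i \<subseteq> fs ! Suc i" if "i \<le> d" for i
  proof (cases "i = d")
    case True
    have "gs ! d \<subseteq> P" using gs(1)[of d] face_of_imp_subset GP by blast
    then show ?thesis using True nth[of i] nth[of "Suc i"] by simp
  next
    case False
    then show ?thesis using that nth[of i] nth[of "Suc i"] chain[of i] by simp
  qed
  moreover have "length fs = Suc (Suc d)" using len *(1) by simp
  ultimately show "fs \<in> flags P"
    using d by (simp add: flags_def less_Suc_eq_le)
qed

text \<open>
  The ray from the centre \<open>q P\<close> through \<open>x\<close> leaves \<open>P\<close> in a point of some facet, and by induction that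
  point lies in the simplex of a flag of the facet.
\<close>

lemma flag_simplices_cover:
  assumes "polytope P" "aff_dim P = int d" "x \<in> P"
    and "\<And>F. F face_of P \<Longrightarrow> F \<noteq> {} \<Longrightarrow> q F \<in> rel_interior F"
  shows "\<exists>fs\<in>flags P. \<exists>l. (\<forall>k. 0 \<le> l k) \<and> (\<Sum>k\<le>d. l k) = (1::real) \<and> x = (\<Sum>k\<le>d. l k *\<^sub>R q (fs ! k))"
  using assms
proof (induction d arbitrary: P x)
  case 0
  then have Px: "P = {x}" using aff_dim_eq_0[of P] by auto
  then have "q P \<in> rel_interior P" using 0(4)[of P] face_of_refl[of P] by simp
  then have "q P = x" using rel_interior_subset[of P] Px by auto
  moreover have "[P] \<in> flags P" using flags_zero[of P] 0 by simp
  ultimately show ?case by (intro bexI[of _ "[P]"] exI[of _ "\<lambda>_. 1"]) simp_all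
next
  case (Suc d)
  have cvx: "convex P" "bounded P" "polyhedron P"
    using polytope_imp_convex[OF Suc.prems(1)] polytope_imp_bounded[OF Suc.prems(1)]
      polytope_imp_polyhedron[OF Suc.prems(1)] by simp_all
  have "P \<noteq> {}" using Suc.prems(3) by auto
  then have qP: "q P \<in> rel_interior P" using Suc.prems(4)[OF face_of_refl[OF cvx(1)]] by simp
  have "P \<noteq> {x}" using Suc.prems(2) by auto
  then obtain y where y: "y \<in> rel_frontier P" "x \<in> closed_segment (q P) y"
    using segment_to_rel_frontier[OF cvx(1,2) qP Suc.prems(3)] by metis
  then obtain G where G: "G facet_of P" "y \<in> G"
    using rel_frontier_of_polyhedron[OF cvx(3)] by auto
  have Gf: "G face_of P" "aff_dim G = int d" using G(1) Suc.prems(2) by (auto simp: facet_of_def)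
  have qG: "q F \<in> rel_interior F" if "F face_of G" "F \<noteq> {}" for F
    using Suc.prems(4)[OF face_of_trans[OF that(1) Gf(1)] that(2)] .
  obtain gs l where gs: "gs \<in> flags G" and l: "\<forall>k. 0 \<le> l k" "(\<Sum>k\<le>d. l k) = 1" "y = (\<Sum>k\<le>d. l k *\<^sub>R q (gs ! k))"
    using Suc.IH[OF face_of_polytope_polytope[OF Suc.prems(1) Gf(1)] Gf(2) G(2) qG] by metis
  obtain u where u: "0 \<le> u" "u \<le> 1" "x = (1 - u) *\<^sub>R q P + u *\<^sub>R y"
    using y(2) by (auto simp: in_segment)
  \<comment> \<open>The centre of \<open>P\<close> takes the weight that the boundary point leaves.\<close>
  define m where "m = (\<lambda>k. if k \<le> d then u * l k else 1 - u)"
  have len: "length gs = Suc d" using flags_length[OF gs Gf(2)] .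
  have "gs @ [P] \<in> flags P" using flags_Suc[OF Suc.prems(1,2), of "gs @ [P]"] gs Gf by auto
  moreover have "\<forall>k. 0 \<le> m k" using u(1,2) l(1) by (simp add: m_def)
  moreover have "(\<Sum>k\<le>Suc d. m k) = 1" using l(2) by (simp add: m_def flip: sum_distrib_left)
  moreover have "x = (\<Sum>k\<le>Suc d. m k *\<^sub>R q ((gs @ [P]) ! k))"
  proof -
    have "(\<Sum>k\<le>d. m k *\<^sub>R q ((gs @ [P]) ! k)) = u *\<^sub>R y"
      using len by (simp add: m_def nth_append l(3) scaleR_sum_right)
    then show ?thesis using len by (simp add: nth_append u(3)) (simp add: m_def add.commute)
  qed
  ultimately show ?case by metis
qed

lemma rel_interior_convex_sum:
  fixes d :: nat and v :: "nat \<Rightarrow> 'a::euclidean_space"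
  assumes "convex S" "\<And>k. k \<le> d \<Longrightarrow> v k \<in> S" "v d \<in> rel_interior S"
    and "\<And>k. k \<le> d \<Longrightarrow> 0 \<le> l k" "0 < l d" "(\<Sum>k\<le>d. l k) = 1"
  shows "(\<Sum>k\<le>d. l k *\<^sub>R v k) \<in> rel_interior S"
proof (cases "l d = 1")
  case True
  then have "(\<Sum>k<d. l k) = 0" using assms(6) by (simp add: sum.atMost_Suc lessThan_Suc_atMost[symmetric])
  then have "l k = 0" if "k < d" for k using assms(4) that by (subst (asm) sum_nonneg_eq_0_iff) auto
  then show ?thesis using True assms(3) by (simp add: lessThan_Suc_atMost[symmetric])
next
  case False
  have s: "(\<Sum>k<d. l k) = 1 - l d" using assms(6) by (simp add: lessThan_Suc_atMost[symmetric])
  moreover have "(\<Sum>k<d. l k) \<ge> 0" using assms(4) by (intro sum_nonneg) auto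
  ultimately have ld: "0 < 1 - l d" using False by simp
  define y where "y = (\<Sum>k<d. (l k / (1 - l d)) *\<^sub>R v k)"
  have "y \<in> S" unfolding y_def using assms ld s
    by (intro convex_sum) (auto simp flip: sum_divide_distrib)
  moreover have "(\<Sum>k\<le>d. l k *\<^sub>R v k) = y - l d *\<^sub>R (y - v d)"
  proof -
    have "(1 - l d) *\<^sub>R y = (\<Sum>k<d. l k *\<^sub>R v k)" using ld by (simp add: y_def scaleR_sum_right)
    then show ?thesis by (simp add: lessThan_Suc_atMost[symmetric] algebra_simps)
  qed
  ultimately show ?thesis
    using rel_interior_convex_shrink[OF assms(1,3), of y "l d"] assms(5) ld by simp
qed

text \<open>
  The ray from the centre of \<open>P\<close> through a common point of the two simplices meets the boundary in only
  one point, so both representations project to the same boundary point. For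
  \<open>fs\<close> this point is in the relative interior of the facet that \<open>fs\<close> contains, hence the facet of \<open>gs\<close>
  is the same one, and the induction goes on inside it.
\<close>

lemma flag_simplices_disjoint:
  assumes "polytope P" "aff_dim P = int d" "fs \<in> flags P" "gs \<in> flags P"
    and q: "\<And>F. F face_of P \<Longrightarrow> F \<noteq> {} \<Longrightarrow> q F \<in> rel_interior F"
    and l: "\<And>k. k \<le> d \<Longrightarrow> 0 < l k" "(\<Sum>k\<le>d. l k) = (1::real)"
    and m: "\<And>k. k \<le> d \<Longrightarrow> 0 \<le> m k" "(\<Sum>k\<le>d. m k) = (1::real)"
    and eq: "(\<Sum>k\<le>d. l k *\<^sub>R q (fs ! k)) = (\<Sum>k\<le>d. m k *\<^sub>R q (gs ! k))"
  shows "fs = gs"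
  using assms
proof (induction d arbitrary: P fs gs l m)
  case 0
  then show ?case using flags_zero[of P] by simp
next
  case (Suc d)
  note P = Suc.prems(1,2)
  obtain F fs' where F: "fs = fs' @ [P]" "F face_of P" "aff_dim F = int d" "fs' \<in> flags F"
    using Suc.prems(3) flags_Suc[OF P] by blast
  obtain G gs' where G: "gs = gs' @ [P]" "G face_of P" "aff_dim G = int d" "gs' \<in> flags G"
    using Suc.prems(4) flags_Suc[OF P] by blast
  have len: "length fs' = Suc d" "length gs' = Suc d" using flags_length[OF F(4,3)] flags_length[OF G(4,3)] by simp_all
  have cvx: "convex P" "convex F" "convex G"
    using polytope_imp_convex[OF P(1)] face_of_imp_convex[OF F(2)] face_of_imp_convex[OF G(2)] by simp_all
  have qP: "q P \<in> rel_interior P" using P(2) Suc.prems(5)[OF face_of_refl[OF cvx(1)]] by (cases "P = {}") auto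
  have qF: "q H \<in> rel_interior H" if "H face_of F" "H \<noteq> {}" for H
    using face_of_trans[OF that(1) F(2)] Suc.prems(5) that(2) by simp
  have qG: "q H \<in> rel_interior H" if "H face_of G" "H \<noteq> {}" for H
    using face_of_trans[OF that(1) G(2)] Suc.prems(5) that(2) by simp
  have proper: "H \<inter> rel_interior P = {}" if "H face_of P" "aff_dim H = int d" for H
    using face_of_disjoint_rel_interior[OF that(1)] that(2) P(2) by (cases "H = P") auto
  have in_flag: "q (hs ! k) \<in> H \<and> hs ! k face_of H"
    if "hs \<in> flags H" "k \<le> d" "aff_dim H = int d" "\<And>E. E face_of H \<Longrightarrow> E \<noteq> {} \<Longrightarrow> q E \<in> rel_interior E"
    for hs k and H :: "'a set"
  proof -
    have h: "hs ! k face_of H" "aff_dim (hs ! k) = int k"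
      using that(1,2) flags_length[OF that(1,3)] by (auto simp: flags_def)
    then have "hs ! k \<noteq> {}" by auto
    with h show ?thesis using that(4)[of "hs ! k"] rel_interior_subset[of "hs ! k"] face_of_imp_subset[of "hs ! k" H] by auto
  qed
  define a where "a = 1 - l (Suc d)"
  define b where "b = 1 - m (Suc d)"
  have sl: "(\<Sum>k\<le>d. l k) = a" and sm: "(\<Sum>k\<le>d. m k) = b" using Suc.prems(7,9) by (auto simp: a_def b_def)
  have a0: "a > 0" unfolding sl[symmetric] by (rule sum_pos) (use Suc.prems(6) in auto)
  have b0: "b \<ge> 0" unfolding sm[symmetric] by (rule sum_nonneg) (use Suc.prems(8) in auto)
  define y where "y = (\<Sum>k\<le>d. (l k / a) *\<^sub>R q (fs' ! k))"
  define z where "z = (\<Sum>k\<le>d. (m k / b) *\<^sub>R q (gs' ! k))"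
  have lastF: "fs' ! d = F" using last_flag[OF face_of_polytope_polytope[OF P(1) F(2)] F(4)] len
    by (metis last_conv_nth diff_Suc_1 list.size(3) old.nat.distinct(2))
  have FNE: "F \<noteq> {}" using F(3) by auto
  have yF: "y \<in> rel_interior F" unfolding y_def
    using Suc.prems(6) a0 sl in_flag[OF F(4) _ F(3) qF] cvx lastF qF[OF face_of_refl[OF cvx(2)] FNE]
    by (intro rel_interior_convex_sum) (auto simp: less_imp_le simp flip: sum_divide_distrib)
  have zG: "z \<in> G" if "b > 0" unfolding z_def
    using Suc.prems(8) that sm in_flag[OF G(4) _ G(3) qG] cvx
    by (intro convex_sum) (auto simp flip: sum_divide_distrib)
  have eq: "a *\<^sub>R y + (1 - a) *\<^sub>R q P = b *\<^sub>R z + (1 - b) *\<^sub>R q P"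
  proof -
    have "a *\<^sub>R y = (\<Sum>k\<le>d. l k *\<^sub>R q (fs ! k))" using a0 len by (simp add: y_def F(1) nth_append scaleR_sum_right)
    moreover have "b *\<^sub>R z = (\<Sum>k\<le>d. m k *\<^sub>R q (gs ! k))"
    proof (cases "b = 0")
      case True
      then have "m k = 0" if "k \<le> d" for k
        using sm Suc.prems(8) that True sum_nonneg_eq_0_iff[of "{..d}" m] by auto
      with True show ?thesis by simp
    next
      case False
      then show ?thesis using len by (simp add: z_def G(1) nth_append scaleR_sum_right)
    qed
    ultimately show ?thesis using Suc.prems(10) len by (simp add: F(1) G(1) nth_append a_def b_def)
  qed
  \<comment> \<open>A boundary point \<open>w\<close> cannot be closer to the centre than another point \<open>w'\<close> of \<open>P\<close> on the same ray:
      it would lie in the relative interior.\<close>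
  have shrink: False if "0 < s" "t < s" "0 \<le> t" "s *\<^sub>R w + (1 - s) *\<^sub>R q P = t *\<^sub>R w' + (1 - t) *\<^sub>R q P" "w \<in> H" "t > 0 \<Longrightarrow> w' \<in> P"
     "H face_of P" "aff_dim H = int d" for s t w w' H
  proof -
    have "s *\<^sub>R w = t *\<^sub>R w' + (s - t) *\<^sub>R q P" using that(4) by (simp add: algebra_simps)
    then have "w = (1/s) *\<^sub>R (t *\<^sub>R w' + (s - t) *\<^sub>R q P)" using that(1) by (metis divide_self_if less_irrefl scaleR_one scaleR_scaleR times_divide_eq_left mult_1)
    also have "\<dots> = (t/s) *\<^sub>R w' + (1 - t/s) *\<^sub>R q P" using that(1) by (simp add: scaleR_right_distrib diff_divide_distrib)
    finally have w: "w = (t/s) *\<^sub>R w' + (1 - t/s) *\<^sub>R q P" .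
    have "w \<in> rel_interior P"
    proof (cases "t = 0")
      case True
      then show ?thesis using w qP by simp
    next
      case False
      then have "w' \<in> P" using that by simp
      moreover have "w = w' - (1 - t/s) *\<^sub>R (w' - q P)" using w by (simp add: algebra_simps)
      moreover have "w' - (1 - t/s) *\<^sub>R (w' - q P) \<in> rel_interior P" if "w' \<in> P"
        using rel_interior_convex_shrink[OF cvx(1) qP that, of "1 - t/s"] \<open>0 < s\<close> \<open>t < s\<close> \<open>0 \<le> t\<close> False
        by (simp add: field_simps)
      ultimately show ?thesis by metis
    qed
    then show False using that proper by blast
  qed
  have ab: "a = b"
  proof (rule ccontr)
    assume "a \<noteq> b"
    then consider "b < a" | "a < b" by linarith
    then show False
    proof cases
      case 1
      have "y \<in> F" using yF rel_interior_subset by auto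
      moreover have "z \<in> P" if "b > 0" using zG[OF that] face_of_imp_subset[OF G(2)] by auto
      ultimately show False using shrink[OF a0 1 b0 eq _ _ F(2,3)] by simp
    next
      case 2
      then have "b > 0" using a0 by simp
      have "y \<in> P" using yF rel_interior_subset[of F] face_of_imp_subset[OF F(2)] by auto
      then show False using shrink[OF \<open>b > 0\<close> 2 _ eq[symmetric] zG[OF \<open>b > 0\<close>] _ G(2,3)] a0 by simp
    qed
  qed
  then have "y = z" using eq a0 by simp
  have "F \<subseteq> G"
    using subset_of_face_of[OF G(2) face_of_imp_subset[OF F(2)]] yF zG ab a0 \<open>y = z\<close> by (auto simp: disjnt_def)
  then have "F face_of G" by (rule face_of_subset[OF F(2) _ face_of_imp_subset[OF G(2)]])
  then have FG: "F = G" using face_of_aff_dim_lt[OF cvx(3), of F] F(3) G(3) by auto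
  have "fs' = gs'"
  proof (rule Suc.IH[OF face_of_polytope_polytope[OF P(1) F(2)] F(3,4)])
    show "gs' \<in> flags F" using G(4) FG by simp
    show "(\<Sum>k\<le>d. (l k / a) *\<^sub>R q (fs' ! k)) = (\<Sum>k\<le>d. (m k / b) *\<^sub>R q (gs' ! k))"
      using \<open>y = z\<close> by (simp add: y_def z_def)
  qed (use qF Suc.prems(6,8) a0 ab sl sm in \<open>auto simp flip: sum_divide_distrib\<close>)
  then show ?case using F G by simp
qed

section \<open>The polar volume as a measurable function\<close>

text \<open>
  Polar volume is the measure of the fibres of a closed subset of the product space.
\<close>

lemma measurable_polar_volume [measurable]:
  fixes K :: "'a::euclidean_space set"
  shows "(\<lambda>x. emeasure lborel (polar_at K x)) \<in> borel_measurable borel"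
proof -
  define G where "G = {z :: 'a \<times> 'a. snd z \<in> polar_at K (fst z)}"
  have "G = (\<Inter>y\<in>K. {z. snd z \<bullet> (y - fst z) \<le> 1})" by (auto simp: G_def polar_at_def)
  then have "closed G" by (auto intro!: closed_INT closed_Collect_le continuous_intros)
  then have "G \<in> sets (borel \<Otimes>\<^sub>M borel)" using borel_closed borel_prod by metis
  then have "G \<in> sets (borel \<Otimes>\<^sub>M lborel)"
    using sets_pair_measure_cong[OF refl sets_lborel, of borel] by simp
  from lborel.measurable_emeasure_Pair[OF this] show ?thesis
    by (simp add: G_def vimage_def)
qed

lemma closed_polar_at: "closed (polar_at K x)"
proof -
  have "polar_at K x = (\<Inter>y\<in>K. {\<xi>. \<xi> \<bullet> (y - x) \<le> 1})" by (auto simp: polar_at_def)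
  then show ?thesis by (auto intro!: closed_INT closed_Collect_le continuous_intros)
qed

section \<open>The chart of a flag simplex\<close>

text \<open>
  This is what the analysis needs to know about the points chosen on a flag. Condition \<open>bump\<close> holds because
  \<open>p k\<close> is in the relative interior of a face that contains all earlier points: one may move from \<open>p k\<close>
  in the direction of an earlier edge without leaving \<open>P\<close>. Condition \<open>support\<close> provides the supporting
  hyperplane of the \<open>i\<close>-th face, normalised at \<open>p (Suc i)\<close>; it annihilates the edges inside that face,
  which makes the matrix of functionals against edges unitriangular.
\<close>

locale flag_frame =
  fixes P :: "'a::euclidean_space set" and p :: "nat \<Rightarrow> 'a"
  assumes convex: "convex P"
    and in_P: "k \<le> DIM('a) \<Longrightarrow> p k \<in> P"
    and bump: "\<exists>c>0. \<forall>i<DIM('a). \<forall>k\<in>{i<..DIM('a)}. p k + c *\<^sub>R (p (Suc i) - p i) \<in> P"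
    and support: "i < DIM('a) \<Longrightarrow> \<exists>a. (\<forall>y\<in>P. 0 \<le> a \<bullet> (y - p 0)) \<and>
        (\<forall>j<i. a \<bullet> (p (Suc j) - p j) = 0) \<and> a \<bullet> (p (Suc i) - p i) = 1"
begin

definition edge :: "'a coord \<Rightarrow> 'a" where
  "edge i = p (Suc (Rep_coord i)) - p (Rep_coord i)"

definition edge_map :: "real^'a coord \<Rightarrow> 'a" where
  "edge_map s = (\<Sum>i\<in>UNIV. s $ i *\<^sub>R edge i)"

definition chart :: "real^'a coord \<Rightarrow> 'a" where
  "chart s = p 0 + edge_map s"

lemma Rep_lt: "Rep_coord (i::'a coord) < DIM('a)"
  using Rep_coord by simp

lemma supportE:
  obtains a where "\<And>i y. y \<in> P \<Longrightarrow> 0 \<le> a i \<bullet> (y - p 0)" "\<And>i j. j < i \<Longrightarrow> a i \<bullet> edge j = 0" "\<And>i. a i \<bullet> edge i = 1"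
proof -
  have "\<forall>i::'a coord. \<exists>a. (\<forall>y\<in>P. 0 \<le> a \<bullet> (y - p 0)) \<and> (\<forall>j<i. a \<bullet> edge j = 0) \<and> a \<bullet> edge i = 1"
    using support[OF Rep_lt] by (simp add: edge_def less_coord_def) blast
  then show thesis using that by metis
qed

lemma linear_edge_map: "linear edge_map"
  by (auto simp: edge_map_def scaleR_left_distrib sum.distrib scaleR_sum_right intro!: linearI)

text \<open>
  Applying the functional with index \<open>m\<close> isolates the coordinate \<open>m\<close>, if that is the last one that does
  not vanish.
\<close>

lemma inj_edge_map: "inj edge_map"
proof -
  obtain a where a: "\<And>i j. j < i \<Longrightarrow> a i \<bullet> edge j = 0" "\<And>i. a i \<bullet> edge i = 1"
    by (rule supportE) blast
  have "s = 0" if "edge_map s = 0" for s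
  proof (rule ccontr)
    assume "s \<noteq> 0"
    then have ne: "{i. s $ i \<noteq> 0} \<noteq> {}" by (auto simp: vec_eq_iff)
    define m where "m = Max {i. s $ i \<noteq> 0}"
    have m: "s $ m \<noteq> 0" using Max_in[OF finite ne] by (simp add: m_def)
    have zero: "s $ i = 0" if "m < i" for i
    proof (rule ccontr)
      assume "s $ i \<noteq> 0"
      then have "i \<le> m" unfolding m_def by (intro Max_ge) auto
      with that show False by simp
    qed
    have "0 = a m \<bullet> edge_map s" using that by simp
    also have "\<dots> = (\<Sum>i\<in>UNIV. s $ i * (a m \<bullet> edge i))" by (simp add: edge_map_def inner_sum_right)
    also have "\<dots> = (\<Sum>i\<in>UNIV. if i = m then s $ m else 0)"
    proof (rule sum.cong)
      fix i show "s $ i * (a m \<bullet> edge i) = (if i = m then s $ m else 0)"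
        using a zero by (cases i m rule: linorder_cases) auto
    qed simp
    finally show False using m by simp
  qed
  then show ?thesis using linear_edge_map by (simp add: linear_injective_0)
qed

lemma edge_map_surj: obtains s where "edge_map s = x"
proof -
  have "dim (range edge_map) = DIM('a)"
    using dim_image_eq[OF linear_edge_map, of UNIV] inj_edge_map by (simp add: CARD_coord)
  then have "span (range edge_map) = UNIV" by (simp add: dim_eq_full)
  then have "range edge_map = UNIV" using linear_subspace_image[OF linear_edge_map subspace_UNIV] by (metis span_eq_iff)
  then show thesis using that by (metis surjD)
qed

lemma adjoint_edge_map: "adjoint edge_map \<xi> $ i = \<xi> \<bullet> edge i"
proof -
  have "adjoint edge_map = (\<lambda>\<xi>. \<chi> i. \<xi> \<bullet> edge i)"
    by (rule adjoint_unique) (simp add: edge_map_def inner_sum_left inner_vec_def inner_commute[of "edge _"])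
  then show ?thesis by simp
qed

lemma chart_add: "chart (s + r) = chart s + edge_map r"
  by (simp add: chart_def linear_add[OF linear_edge_map])

lemma edge_map_axis: "edge_map (axis i r) = r *\<^sub>R edge i"
  by (simp add: edge_map_def axis_def if_distrib if_distribR cong: if_cong)

text \<open>
  The weights are the successive differences of \<open>1, s\<^sub>0, \<dots>, s\<^sub>n\<^sub>-\<^sub>1, 0\<close>. With \<open>chart_weights\<close> they translate
  between edge coordinates and barycentric coordinates.
\<close>

lemma decreasing_simplex_weights:
  fixes s :: "real^'a coord"
  assumes "s \<in> decreasing_simplex"
  obtains l where "\<And>k. 0 \<le> l k" "(\<Sum>k\<le>DIM('a). l k) = 1" "\<And>i. s $ i = (\<Sum>k\<in>{Rep_coord i<..DIM('a)}. l k)"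
proof -
  let ?n = "DIM('a)"
  \<comment> \<open>The sequence \<open>1, s\<^sub>0, \<dots>, s\<^sub>n\<^sub>-\<^sub>1, 0\<close>, shifted by one so that \<open>\<sigma> (Suc k)\<close> is \<open>s\<^sub>k\<close>.\<close>
  define \<sigma> where "\<sigma> = (\<lambda>k. if k = 0 then 1 else if k \<le> ?n then s $ Abs_coord (k - 1) else 0)"
  have RA: "Rep_coord (Abs_coord k :: 'a coord) = k" if "k < ?n" for k
    using that by (simp add: Abs_coord_inverse)
  have mono: "\<sigma> (Suc k) \<le> \<sigma> k" for k
    using assms by (auto simp: \<sigma>_def decreasing_simplex_def less_eq_coord_def RA)
  have tele: "(\<Sum>k\<in>{j<..?n}. \<sigma> k - \<sigma> (Suc k)) = \<sigma> (Suc j)" if "j \<le> ?n" for j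
  proof -
    have "(\<Sum>k\<in>{j<..?n}. \<sigma> k - \<sigma> (Suc k)) = (\<Sum>k\<in>{Suc j..<Suc ?n}. \<sigma> k - \<sigma> (Suc k))"
      by (rule sum.cong) auto
    also have "\<dots> = - (\<Sum>k\<in>{Suc j..<Suc ?n}. \<sigma> (Suc k) - \<sigma> k)" by (simp flip: sum_negf)
    also have "\<dots> = \<sigma> (Suc j) - \<sigma> (Suc ?n)" using that by (subst sum_Suc_diff') auto
    finally show ?thesis by (simp add: \<sigma>_def)
  qed
  show thesis
  proof
    show "0 \<le> \<sigma> k - \<sigma> (Suc k)" for k using mono by simp
    have "{..?n} = insert 0 {0<..?n}" by auto
    then show "(\<Sum>k\<le>?n. \<sigma> k - \<sigma> (Suc k)) = 1" using tele[of 0] by (simp add: \<sigma>_def)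
    show "s $ i = (\<Sum>k\<in>{Rep_coord i<..?n}. \<sigma> k - \<sigma> (Suc k))" for i
      using Rep_lt[of i] by (subst tele) (auto simp: \<sigma>_def Rep_coord_inverse)
  qed
qed

lemma chart_weights:
  assumes "(\<Sum>k\<le>DIM('a). l k) = 1" "\<And>i. s $ i = (\<Sum>k\<in>{Rep_coord i<..DIM('a)}. l k)"
  shows "chart s = (\<Sum>k\<le>DIM('a). l k *\<^sub>R p k)"
proof -
  let ?n = "DIM('a)"
  have "edge_map s = (\<Sum>i<?n. (\<Sum>k\<in>{i<..?n}. l k) *\<^sub>R (p (Suc i) - p i))"
    unfolding edge_map_def assms(2) edge_def
    by (rule sum_coord[of "\<lambda>i. (\<Sum>k\<in>{i<..?n}. l k) *\<^sub>R (p (Suc i) - p i)"])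
  also have "\<dots> = (\<Sum>i<?n. \<Sum>k\<in>{k\<in>{..?n}. i < k}. l k *\<^sub>R (p (Suc i) - p i))"
    by (intro sum.cong refl) (auto simp: scaleR_sum_left intro!: sum.cong)
  also have "\<dots> = (\<Sum>k\<le>?n. \<Sum>i\<in>{i\<in>{..<?n}. i < k}. l k *\<^sub>R (p (Suc i) - p i))"
    by (rule sum.swap_restrict) auto
  also have "\<dots> = (\<Sum>k\<le>?n. l k *\<^sub>R (p k - p 0))"
  proof (intro sum.cong refl)
    fix k assume "k \<in> {..?n}"
    then have "{i\<in>{..<?n}. i < k} = {..<k}" by auto
    then show "(\<Sum>i\<in>{i\<in>{..<?n}. i < k}. l k *\<^sub>R (p (Suc i) - p i)) = l k *\<^sub>R (p k - p 0)"
      by (simp add: sum_lessThan_telescope flip: scaleR_sum_right)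
  qed
  also have "\<dots> = (\<Sum>k\<le>?n. l k *\<^sub>R p k) - p 0"
    using assms(1) by (simp add: scaleR_diff_right sum_subtractf flip: scaleR_sum_left)
  finally show ?thesis by (simp add: chart_def)
qed

text \<open>
  The last coordinate \<open>s\<^sub>n\<^sub>-\<^sub>1\<close> is both the smallest one and the weight at \<open>p\<^sub>n\<close>, so the truncation is
  a bound on that single weight.
\<close>

lemma chart_region:
  "x \<in> chart ` {s\<in>decreasing_simplex. \<forall>i. \<epsilon> \<le> s $ i} \<longleftrightarrow>
   (\<exists>l. (\<forall>k. 0 \<le> l k) \<and> (\<Sum>k\<le>DIM('a). l k) = 1 \<and> \<epsilon> \<le> l DIM('a) \<and> x = (\<Sum>k\<le>DIM('a). l k *\<^sub>R p k))"
proof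
  let ?n = "DIM('a)"
  assume "x \<in> chart ` {s\<in>decreasing_simplex. \<forall>i. \<epsilon> \<le> s $ i}"
  then obtain s where s: "s \<in> decreasing_simplex" "\<And>i. \<epsilon> \<le> s $ i" "x = chart s" by auto
  obtain l where l: "\<And>k. 0 \<le> l k" "(\<Sum>k\<le>?n. l k) = 1" "\<And>i. s $ i = (\<Sum>k\<in>{Rep_coord i<..?n}. l k)"
    using s(1) by (rule decreasing_simplex_weights) blast
  obtain i :: "'a coord" where "Rep_coord i = ?n - 1"
    by (metis Abs_coord_inverse DIM_positive diff_less lessThan_iff zero_less_one)
  then have "{Rep_coord i<..?n} = {?n}" by auto
  then have "\<epsilon> \<le> l ?n" using s(2)[of i] l(3)[of i] by simp
  then show "\<exists>l. (\<forall>k. 0 \<le> l k) \<and> (\<Sum>k\<le>?n. l k) = 1 \<and> \<epsilon> \<le> l ?n \<and> x = (\<Sum>k\<le>?n. l k *\<^sub>R p k)"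
    using l chart_weights[OF l(2,3)] s(3) by metis
next
  let ?n = "DIM('a)"
  assume "\<exists>l. (\<forall>k. 0 \<le> l k) \<and> (\<Sum>k\<le>?n. l k) = 1 \<and> \<epsilon> \<le> l ?n \<and> x = (\<Sum>k\<le>?n. l k *\<^sub>R p k)"
  then obtain l where l: "\<And>k. 0 \<le> l k" "(\<Sum>k\<le>?n. l k) = 1" "\<epsilon> \<le> l ?n" "x = (\<Sum>k\<le>?n. l k *\<^sub>R p k)"
    by blast
  define s :: "real^'a coord" where "s = (\<chi> i. \<Sum>k\<in>{Rep_coord i<..?n}. l k)"
  have "x = chart s" using chart_weights[OF l(2), of s] l(4) by (simp add: s_def)
  moreover have "\<epsilon> \<le> s $ i" for i
    using l(1) member_le_sum[of ?n "{Rep_coord i<..?n}" l] Rep_lt[of i] l(3) by (simp add: s_def)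
  moreover have "s \<in> decreasing_simplex"
  proof -
    have "s $ i \<le> 1" for i
    proof -
      have "(\<Sum>k\<in>{Rep_coord i<..?n}. l k) \<le> (\<Sum>k\<le>?n. l k)" using l(1) by (intro sum_mono2) auto
      then show ?thesis by (simp add: s_def l(2))
    qed
    moreover have "s $ j \<le> s $ i" if "i \<le> j" for i j
      using that l(1) by (auto simp: s_def less_eq_coord_def intro!: sum_mono2)
    ultimately show ?thesis using l(1) by (auto simp: decreasing_simplex_def s_def intro!: sum_nonneg)
  qed
  ultimately show "x \<in> chart ` {s\<in>decreasing_simplex. \<forall>i. \<epsilon> \<le> s $ i}" by blast
qed

lemma chart_in_P: "s \<in> decreasing_simplex \<Longrightarrow> chart s \<in> P"
  by (erule decreasing_simplex_weights, subst chart_weights) (auto intro!: convex_sum convex in_P)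

text \<open>
  The point \<open>chart s\<close> carries total weight \<open>s\<^sub>i\<close> on the points \<open>p k\<close> with \<open>k > i\<close>, each of which may be
  moved by \<open>c\<close> along the edge \<open>i\<close>. The room to move is thus proportional to \<open>s\<^sub>i\<close>, uniformly in \<open>s\<close>.
\<close>

lemma chart_bump:
  obtains c where "c > 0" "\<And>s i. s \<in> decreasing_simplex \<Longrightarrow> chart s + (c * s $ i) *\<^sub>R edge i \<in> P"
proof -
  obtain c where c: "c > 0" "\<And>i k. i < DIM('a) \<Longrightarrow> i < k \<Longrightarrow> k \<le> DIM('a) \<Longrightarrow> p k + c *\<^sub>R (p (Suc i) - p i) \<in> P"
    using bump by auto
  show thesis
  proof (rule that[OF c(1)])
    fix s :: "real^'a coord" and i assume "s \<in> decreasing_simplex"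
    then obtain l where l: "\<And>k. 0 \<le> l k" "(\<Sum>k\<le>DIM('a). l k) = 1" "\<And>i. s $ i = (\<Sum>k\<in>{Rep_coord i<..DIM('a)}. l k)"
      by (rule decreasing_simplex_weights) blast
    let ?v = "\<lambda>k. if Rep_coord i < k then p k + c *\<^sub>R edge i else p k"
    have "(\<Sum>k\<le>DIM('a). l k *\<^sub>R ?v k) \<in> P"
      using l c(2) Rep_lt[of i] by (intro convex_sum convex) (auto simp: in_P edge_def)
    also have "(\<Sum>k\<le>DIM('a). l k *\<^sub>R ?v k) = (\<Sum>k\<le>DIM('a). l k *\<^sub>R p k + (if Rep_coord i < k then l k else 0) *\<^sub>R c *\<^sub>R edge i)"
      by (intro sum.cong) (auto simp: scaleR_right_distrib)
    also have "\<dots> = chart s + (\<Sum>k\<le>DIM('a). if Rep_coord i < k then l k else 0) *\<^sub>R c *\<^sub>R edge i"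
      by (simp only: sum.distrib scaleR_sum_left chart_weights[OF l(2,3)])
    also have "(\<Sum>k\<le>DIM('a). if Rep_coord i < k then l k else 0) = s $ i"
      unfolding l(3) by (auto simp: sum.If_cases intro!: sum.cong)
    finally show "chart s + (c * s $ i) *\<^sub>R edge i \<in> P" by (simp add: mult.commute)
  qed
qed

section \<open>The polar body in the coordinates of a flag\<close>

text \<open>
  The polar body in coordinates dual to the edges, rescaled by \<open>s\<close> so that it stays bounded as the
  polar body itself degenerates, and with the sign for which the limit is the standard simplex.
\<close>

definition dual_body :: "real^'a coord \<Rightarrow> (real^'a coord) set" where
  "dual_body s = {\<eta>. \<exists>\<xi>\<in>polar_at P (chart s). \<forall>i. \<eta> $ i = - (s $ i) * (\<xi> \<bullet> edge i)}"

lemma polar_point: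
  assumes "\<xi> \<in> polar_at P (chart s)" "chart s + v \<in> P"
  shows "\<xi> \<bullet> v \<le> 1"
  using assms by (force simp: polar_at_def)

text \<open>
  The sum of the coordinates is \<open>\<langle>\<xi>, p\<^sub>0 - x\<rangle>\<close>, so this is the polar inequality at the vertex of the flag.
\<close>

lemma dual_body_sum:
  assumes "\<eta> \<in> dual_body s" shows "(\<Sum>i\<in>UNIV. \<eta> $ i) \<le> 1"
proof -
  obtain \<xi> where \<xi>: "\<xi> \<in> polar_at P (chart s)" "\<And>i. \<eta> $ i = - (s $ i) * (\<xi> \<bullet> edge i)"
    using assms by (auto simp: dual_body_def)
  have "\<xi> \<bullet> (- edge_map s) \<le> 1" by (rule polar_point[OF \<xi>(1)]) (use in_P[of 0] in \<open>simp add: chart_def\<close>)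
  also have "\<xi> \<bullet> (- edge_map s) = (\<Sum>i\<in>UNIV. \<eta> $ i)"
    by (simp add: edge_map_def \<xi>(2) inner_sum_right sum_negf)
  finally show ?thesis .
qed

lemma dual_body_bounded:
  obtains C where "\<And>s \<eta> i. s \<in> decreasing_simplex \<Longrightarrow> \<eta> \<in> dual_body s \<Longrightarrow> - C \<le> \<eta> $ i"
proof -
  obtain c where c: "c > 0" "\<And>s i. s \<in> decreasing_simplex \<Longrightarrow> chart s + (c * s $ i) *\<^sub>R edge i \<in> P" by (rule chart_bump) blast
  show thesis
  proof (rule that)
    fix s \<eta> i assume s: "s \<in> decreasing_simplex" "\<eta> \<in> dual_body s"
    then obtain \<xi> where \<xi>: "\<xi> \<in> polar_at P (chart s)" "\<And>i. \<eta> $ i = - (s $ i) * (\<xi> \<bullet> edge i)"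
      by (auto simp: dual_body_def)
    have "\<xi> \<bullet> ((c * s $ i) *\<^sub>R edge i) \<le> 1" using polar_point[OF \<xi>(1) c(2)[OF s(1)]] .
    then show "- (1 / c) \<le> \<eta> $ i" using c(1) by (simp add: \<xi>(2) field_simps)
  qed
qed

text \<open>
  If \<open>s\<^sub>i\<close> is much smaller than all earlier coordinates, it can be enlarged by the factor \<open>1 + M\<close> inside
  the flag simplex. The polar inequality at the resulting point shows that \<open>\<eta>\<^sub>i\<close> is at least \<open>- 1 / M\<close>, that
  is, almost nonnegative.
\<close>

lemma dual_body_upper:
  assumes s: "s \<in> decreasing_simplex" "\<eta> \<in> dual_body s" and M: "0 \<le> M" "(1 + M) * s $ i \<le> 1" "\<And>j. j < i \<Longrightarrow> (1 + M) * s $ i \<le> s $ j"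
  shows "- (M * \<eta> $ i) \<le> 1"
proof -
  obtain \<xi> where \<xi>: "\<xi> \<in> polar_at P (chart s)" "\<And>i. \<eta> $ i = - (s $ i) * (\<xi> \<bullet> edge i)"
    using s(2) by (auto simp: dual_body_def)
  have "s + axis i (M * s $ i) \<in> decreasing_simplex"
  proof -
    have mono: "s $ k \<le> s $ j" if "j \<le> k" for j k using s(1) that by (auto simp: decreasing_simplex_def)
    have nn: "0 \<le> s $ j" "s $ j \<le> 1" for j using s(1) by (auto simp: decreasing_simplex_def)
    have "0 \<le> M * s $ i" using M(1) nn by simp
    then show ?thesis
      unfolding decreasing_simplex_def mem_Collect_eq
    proof (intro conjI allI impI)
      fix j k :: "'a coord" assume jk: "j \<le> k"
      show "(s + axis i (M * s $ i)) $ k \<le> (s + axis i (M * s $ i)) $ j"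
        using mono[OF jk] \<open>0 \<le> M * s $ i\<close> M(3)[of j] jk by (auto simp: axis_def algebra_simps)
    qed (use nn M in \<open>auto simp: axis_def algebra_simps\<close>)
  qed
  from chart_in_P[OF this] have "chart s + (M * s $ i) *\<^sub>R edge i \<in> P" by (simp add: chart_add edge_map_axis)
  from polar_point[OF \<xi>(1) this] show ?thesis by (simp add: \<xi>(2) mult.assoc)
qed

text \<open>
  For \<open>y = p\<^sub>0 + \<Sum>\<^sub>i \<tau>\<^sub>i b\<^sub>i\<close> and \<open>z\<^sub>i = \<tau>\<^sub>i / s\<^sub>i\<close>, the polar inequality at \<open>y\<close> reads
  \<open>\<Sum>\<^sub>i \<eta>\<^sub>i (1 - z\<^sub>i) \<le> 1\<close>, so it suffices that \<open>\<Sum>\<^sub>i \<eta>\<^sub>i z\<^sub>i \<ge> 0\<close>. The supporting functional with index \<open>i\<close>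
  is nonnegative on \<open>y - p\<^sub>0\<close> and sees \<open>\<tau>\<^sub>i\<close> with coefficient \<open>1\<close>, the earlier coordinates not at all, and the
  later ones with coefficients that \<open>small\<close> makes negligible at the scale \<open>s\<^sub>i\<close>. Hence every \<open>z\<^sub>i\<close> is
  nonnegative up to a small multiple of \<open>S = \<Sum>\<^sub>i |z\<^sub>i|\<close>, and since all \<open>\<eta>\<^sub>i\<close> are at least \<open>\<theta>\<close>, the
  positive parts outweigh these errors.
\<close>

lemma dual_body_lower:
  assumes pos: "\<And>i. 0 < s $ i" and \<eta>: "\<And>i. \<theta> \<le> \<eta> $ i" "(\<Sum>i\<in>UNIV. \<eta> $ i) \<le> 1" "0 < \<theta>"
    and small: "\<And>i j. j < i \<Longrightarrow> \<bar>a j \<bullet> edge i\<bar> * s $ i \<le> (\<theta> / 2) * s $ j"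
    and a: "\<And>i y. y \<in> P \<Longrightarrow> 0 \<le> a i \<bullet> (y - p 0)" "\<And>i j. j < i \<Longrightarrow> a i \<bullet> edge j = 0" "\<And>i. a i \<bullet> edge i = 1"
  shows "\<eta> \<in> dual_body s"
proof -
  have surj: "surj (adjoint edge_map)" using inj_edge_map linear_edge_map by simp
  obtain \<xi> where \<xi>: "adjoint edge_map \<xi> = (\<chi> i. - (\<eta> $ i / s $ i))" using surj by (metis surjD)
  have \<xi>e: "\<xi> \<bullet> edge i = - (\<eta> $ i / s $ i)" for i using adjoint_edge_map[of \<xi> i] by (simp add: \<xi>)
  have "\<xi> \<bullet> (y - chart s) \<le> 1" if y: "y \<in> P" for y
  proof -
    obtain \<tau> where \<tau>: "edge_map \<tau> = y - p 0" by (rule edge_map_surj)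
    define z where "z = (\<lambda>i. \<tau> $ i / s $ i)"
    define S where "S = (\<Sum>i\<in>UNIV. \<bar>z i\<bar>)"
    have zS: "\<bar>z i\<bar> - \<theta> * S \<le> z i" for i
    proof -
      have "0 \<le> a i \<bullet> edge_map \<tau>" using a(1)[OF y] \<tau> by simp
      also have "\<dots> = (\<Sum>j\<in>UNIV. \<tau> $ j * (a i \<bullet> edge j))" by (simp add: edge_map_def inner_sum_right)
      also have "\<dots> \<le> (\<Sum>j\<in>UNIV. s $ i * ((if j = i then z i else 0) + \<theta> / 2 * \<bar>z j\<bar>))"
      proof (rule sum_mono)
        fix j
        have "\<tau> $ j * (a i \<bullet> edge j) \<le> s $ i * (\<theta> / 2 * \<bar>z j\<bar>)" if "i < j"
        proof -
          have "\<tau> $ j * (a i \<bullet> edge j) = z j * (s $ j * (a i \<bullet> edge j))" using pos[of j] by (simp add: z_def)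
          also have "\<dots> \<le> \<bar>z j\<bar> * (\<bar>a i \<bullet> edge j\<bar> * s $ j)"
            using pos[of j] by (metis abs_ge_self abs_mult abs_of_pos mult.commute)
          also have "\<dots> \<le> \<bar>z j\<bar> * (\<theta> / 2 * s $ i)" by (intro mult_left_mono small that) auto
          finally show ?thesis by (simp add: mult_ac)
        qed
        moreover have "0 \<le> s $ i * (\<theta> / 2 * \<bar>z j\<bar>)" using pos[of i] \<eta>(3) by simp
        ultimately show "\<tau> $ j * (a i \<bullet> edge j) \<le> s $ i * ((if j = i then z i else 0) + \<theta> / 2 * \<bar>z j\<bar>)"
          using a(2)[of j i] a(3)[of i] pos[of i] by (cases i j rule: linorder_cases) (auto simp: z_def distrib_left)
      qed
      also have "\<dots> = s $ i * (z i + \<theta> / 2 * S)"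
        unfolding sum_distrib_left[symmetric] sum.distrib by (simp add: S_def)
      finally have "0 \<le> z i + \<theta> / 2 * S" using pos[of i] by (simp add: zero_le_mult_iff)
      moreover have "0 \<le> \<theta> * S" using \<eta>(3) by (auto simp: S_def intro!: mult_nonneg_nonneg sum_nonneg)
      ultimately show ?thesis by (auto simp: abs_if)
    qed
    have S0: "0 \<le> \<theta> * S" using \<eta>(3) by (auto simp: S_def intro!: mult_nonneg_nonneg sum_nonneg)
    have "0 \<le> \<theta> * S - \<theta> * S * (\<Sum>i\<in>UNIV. \<eta> $ i)" using mult_left_mono[OF \<eta>(2) S0] by simp
    also have "\<dots> = (\<Sum>i\<in>UNIV. \<theta> * \<bar>z i\<bar> - \<eta> $ i * (\<theta> * S))"
      by (simp add: S_def sum_subtractf sum_distrib_left[symmetric] sum_distrib_right[symmetric] mult_ac)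
    also have "\<dots> \<le> (\<Sum>i\<in>UNIV. \<eta> $ i * z i)"
    proof (rule sum_mono)
      fix i
      have "\<theta> * \<bar>z i\<bar> - \<eta> $ i * (\<theta> * S) \<le> \<eta> $ i * \<bar>z i\<bar> - \<eta> $ i * (\<theta> * S)"
        using \<eta>(1)[of i] by (simp add: mult_right_mono)
      also have "\<dots> = \<eta> $ i * (\<bar>z i\<bar> - \<theta> * S)" by (simp add: algebra_simps)
      also have "\<dots> \<le> \<eta> $ i * z i" using zS \<eta>(1)[of i] \<eta>(3) by (intro mult_left_mono) auto
      finally show "\<theta> * \<bar>z i\<bar> - \<eta> $ i * (\<theta> * S) \<le> \<eta> $ i * z i" .
    qed
    finally have nn: "0 \<le> (\<Sum>i\<in>UNIV. \<eta> $ i * z i)" .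
    have "\<xi> \<bullet> (y - chart s) = \<xi> \<bullet> edge_map \<tau> - \<xi> \<bullet> edge_map s" by (simp add: \<tau> chart_def inner_diff_right inner_add_right)
    also have "\<xi> \<bullet> edge_map \<tau> = - (\<Sum>i\<in>UNIV. \<eta> $ i * z i)"
      by (simp add: edge_map_def inner_sum_right \<xi>e z_def mult_ac flip: sum_negf)
    also have "\<xi> \<bullet> edge_map s = - (\<Sum>i\<in>UNIV. \<eta> $ i)"
      using pos by (simp add: edge_map_def inner_sum_right \<xi>e less_imp_neq[symmetric] flip: sum_negf)
    finally show ?thesis using nn \<eta>(2) by simp
  qed
  then show ?thesis
    using pos \<xi>e unfolding dual_body_def polar_at_def by (auto intro!: exI[of _ \<xi>] simp: less_imp_neq[symmetric])
qed

section \<open>The contribution of one flag\<close>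

text \<open>
  One constant \<open>c\<close> serves as the Jacobian of the chart in the second clause and of the dual coordinates in the
  last one.
\<close>

lemma dual_body_volume:
  obtains c where "c > 0"
    "\<And>f. f \<in> borel_measurable borel \<Longrightarrow> (\<integral>\<^sup>+x. f x \<partial>lborel) = ennreal c * (\<integral>\<^sup>+s. f (edge_map s) \<partial>lborel)"
    "\<And>s. (\<And>i. 0 < s $ i) \<Longrightarrow> dual_body s \<in> sets borel"
    "\<And>s. (\<And>i. 0 < s $ i) \<Longrightarrow> emeasure lborel (dual_body s)
        = ennreal c * emeasure lborel (polar_at P (chart s)) * (\<Prod>i\<in>UNIV. ennreal (s $ i))"
proof -
  obtain c where c: "c > 0"
    "\<And>f. f \<in> borel_measurable borel \<Longrightarrow> (\<integral>\<^sup>+x. f x \<partial>lborel) = ennreal c * (\<integral>\<^sup>+s. f (edge_map s) \<partial>lborel)"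
    "\<And>A. A \<in> sets borel \<Longrightarrow> emeasure lborel A = ennreal c * emeasure lborel (adjoint edge_map -` A)"
    by (rule linear_scaling_adjoint[OF linear_edge_map inj_edge_map CARD_coord]) blast
  have inj_adj: "inj (adjoint edge_map)" using linear_edge_map edge_map_surj by (simp add: surj_def) metis
  have *: "dual_body s \<in> sets borel \<and> emeasure lborel (dual_body s)
        = ennreal c * emeasure lborel (polar_at P (chart s)) * (\<Prod>i\<in>UNIV. ennreal (s $ i))"
    if pos: "\<And>i. 0 < s $ i" for s
  proof -
    define Z where "Z = adjoint edge_map ` polar_at P (chart s)"
    \<comment> \<open>The passage from \<open>(\<langle>\<xi>, b\<^sub>i\<rangle>)\<^sub>i\<close> to \<open>\<eta>\<close>; its determinant contributes the factor \<open>\<Prod>\<^sub>i s\<^sub>i\<close>.\<close>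
    define W :: "real^'a coord \<Rightarrow> real^'a coord" where "W = (\<lambda>\<zeta>. \<chi> i. - (s $ i) * \<zeta> $ i)"
    have linW: "linear W" by (auto simp: W_def vec_eq_iff algebra_simps intro!: linearI)
    have injW: "inj W" using pos by (auto simp: W_def inj_def vec_eq_iff less_imp_neq[symmetric])
    have "closed Z" unfolding Z_def
      using closed_polar_at adjoint_linear[OF linear_edge_map] inj_adj by (rule closed_injective_linear_image)
    then have Z: "Z \<in> sets borel" by simp
    have img: "dual_body s = W ` Z"
    proof (intro set_eqI iffI)
      fix \<eta> assume "\<eta> \<in> dual_body s"
      then obtain \<xi> where "\<xi> \<in> polar_at P (chart s)" "\<And>i. \<eta> $ i = - (s $ i) * (\<xi> \<bullet> edge i)"
        by (auto simp: dual_body_def)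
      then have "\<eta> = W (adjoint edge_map \<xi>)" "adjoint edge_map \<xi> \<in> Z" by (auto simp: W_def Z_def vec_eq_iff adjoint_edge_map)
      then show "\<eta> \<in> W ` Z" by blast
    qed (auto simp: dual_body_def Z_def W_def adjoint_edge_map)
    have "closed (dual_body s)" unfolding img using \<open>closed Z\<close> linW injW by (rule closed_injective_linear_image)
    then have bor: "dual_body s \<in> sets borel" by simp
    have "matrix W $ i $ j = (if i = j then - (s $ i) else 0)" for i j
      by (simp add: matrix_def W_def axis_def)
    then have "det (matrix W) = (\<Prod>i\<in>UNIV. - (s $ i))" by (subst det_diagonal) auto
    then have det: "\<bar>det (matrix W)\<bar> = (\<Prod>i\<in>UNIV. s $ i)" using pos by (simp add: abs_prod less_imp_le)
    have "W -` dual_body s = Z" unfolding img using injW by (simp add: inj_vimage_image_eq)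
    moreover have "adjoint edge_map -` Z = polar_at P (chart s)" unfolding Z_def using inj_adj by (simp add: inj_vimage_image_eq)
    ultimately have "emeasure lborel (dual_body s) = ennreal (\<Prod>i\<in>UNIV. s $ i) * (ennreal c * emeasure lborel (polar_at P (chart s)))"
      using emeasure_linear_vimage[OF linW injW bor] c(3)[OF Z] det by simp
    also have "ennreal (\<Prod>i\<in>UNIV. s $ i) = (\<Prod>i\<in>UNIV. ennreal (s $ i))"
      using pos by (simp add: prod_ennreal less_imp_le)
    finally show ?thesis using bor by (simp add: mult_ac)
  qed
  show thesis by (rule that[OF c(1,2)]) (use * in simp_all)
qed

lemma borel_measurable_chart [measurable]: "chart \<in> borel \<rightarrow>\<^sub>M borel"
  unfolding chart_def using linear_edge_map
  by (intro borel_measurable_continuous_onI continuous_intros linear_continuous_on) (simp add: linear_conv_bounded_linear)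

lemma closed_chart_region: "closed (chart ` {s\<in>decreasing_simplex. \<forall>i. \<epsilon> \<le> s $ i})"
proof -
  have clD: "closed {s\<in>decreasing_simplex. \<forall>i. \<epsilon> \<le> s $ i}" unfolding decreasing_simplex_def
    by (auto intro!: closed_Collect_conj closed_Collect_all closed_Collect_imp closed_Collect_le continuous_intros)
  have "chart ` {s\<in>decreasing_simplex. \<forall>i. \<epsilon> \<le> s $ i} = (+) (p 0) ` edge_map ` {s\<in>decreasing_simplex. \<forall>i. \<epsilon> \<le> s $ i}"
    by (auto simp: chart_def image_image)
  then show ?thesis
    using closed_translation[OF closed_injective_linear_image[OF clD linear_edge_map inj_edge_map]] by simp
qed

text \<open>
  The Jacobian \<open>c\<close> of the chart is absorbed by the volume of the dual body, and the remaining density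
  \<open>\<Prod>\<^sub>i 1 / s\<^sub>i\<close> is the one that exponential coordinates turn into Lebesgue measure. In these
  coordinates the truncation \<open>s\<^sub>i \<ge> exp (- R)\<close> becomes \<open>t\<^sub>i \<le> 1\<close>.
\<close>

lemma nn_integral_chart:
  assumes R: "R > 0"
  shows "(\<integral>\<^sup>+x. emeasure lborel (polar_at P x) * indicator (chart ` {s\<in>decreasing_simplex. \<forall>i. exp (- R) \<le> s $ i}) x \<partial>lborel)
    = ennreal (R ^ DIM('a)) * (\<integral>\<^sup>+t. indicator increasing_simplex t * emeasure lborel (dual_body (\<chi> i. exp (- R * t $ i))) \<partial>lborel)"
proof -
  let ?D = "{s\<in>decreasing_simplex. \<forall>i. exp (- R) \<le> s $ i} :: (real^'a coord) set"
  let ?e = "\<lambda>t::real^'a coord. \<chi> i. exp (- R * t $ i)"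
  obtain c where c: "c > 0"
    "\<And>f. f \<in> borel_measurable borel \<Longrightarrow> (\<integral>\<^sup>+x. f x \<partial>lborel) = ennreal c * (\<integral>\<^sup>+s. f (edge_map s) \<partial>lborel)"
    "\<And>s. (\<And>i. 0 < s $ i) \<Longrightarrow> emeasure lborel (dual_body s)
        = ennreal c * emeasure lborel (polar_at P (chart s)) * (\<Prod>i\<in>UNIV. ennreal (s $ i))"
    by (rule dual_body_volume) blast
  have "closed ?D" unfolding decreasing_simplex_def
    by (auto intro!: closed_Collect_conj closed_Collect_all closed_Collect_imp closed_Collect_le continuous_intros)
  then have [measurable]: "?D \<in> sets borel" by simp
  have [measurable]: "chart ` ?D \<in> sets borel" using closed_chart_region by (rule borel_closed)
  have injc: "inj chart" using inj_edge_map by (auto simp: inj_def chart_def)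
  let ?f = "\<lambda>x. emeasure lborel (polar_at P x) * indicator (chart ` ?D) x"
  \<comment> \<open>For positive \<open>s\<close> this is the volume of the dual body on the truncated simplex, in a form that is
      measurable everywhere.\<close>
  define g where "g = (\<lambda>s. ennreal c * emeasure lborel (polar_at P (chart s)) * (\<Prod>i\<in>UNIV. ennreal (s $ i)) * indicator ?D s)"
  have [measurable]: "g \<in> borel_measurable borel" unfolding g_def by measurable
  have "(\<integral>\<^sup>+x. ?f x \<partial>lborel) = (\<integral>\<^sup>+x. ?f x \<partial>distr lborel borel ((+) (p 0)))"
    by (simp add: lborel_distr_plus)
  also have "\<dots> = (\<integral>\<^sup>+x. ?f (p 0 + x) \<partial>lborel)" by (subst nn_integral_distr) auto
  also have "\<dots> = ennreal c * (\<integral>\<^sup>+s. ?f (chart s) \<partial>lborel)"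
  proof -
    have "?f \<in> borel_measurable borel" by measurable
    then have "(\<lambda>x. ?f (p 0 + x)) \<in> borel_measurable borel" by (rule measurable_compose[rotated]) simp
    from c(2)[OF this] show ?thesis by (simp add: chart_def)
  qed
  also have "\<dots> = (\<integral>\<^sup>+s. ennreal c * ?f (chart s) \<partial>lborel)" by (subst nn_integral_cmult) auto
  also have "\<dots> = (\<integral>\<^sup>+s. ennreal (R ^ DIM('a)) * (g s * indicator {s. \<forall>i. 0 < s $ i} s * (\<Prod>i\<in>UNIV. ennreal (1 / (R * s $ i)))) \<partial>lborel)"
  proof (rule nn_integral_cong)
    fix s :: "real^'a coord"
    show "ennreal c * ?f (chart s) = ennreal (R ^ DIM('a)) * (g s * indicator {s. \<forall>i. 0 < s $ i} s * (\<Prod>i\<in>UNIV. ennreal (1 / (R * s $ i))))"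
    proof (cases "s \<in> ?D")
      case False
      then show ?thesis using injc by (auto simp: g_def inj_image_mem_iff)
    next
      case True
      then have pos: "0 < s $ i" for i by (auto intro: less_le_trans[OF exp_gt_zero])
      have "(\<Prod>i\<in>UNIV. ennreal (s $ i)) * (\<Prod>i\<in>UNIV. ennreal (1 / (R * s $ i))) = ennreal (\<Prod>i\<in>UNIV. s $ i * (1 / (R * s $ i)))"
        unfolding prod.distrib[symmetric] using pos R
        by (subst prod_ennreal[symmetric])
           (auto simp: ennreal_mult[symmetric] less_imp_le simp del: times_divide_eq_right intro!: prod.cong mult_nonneg_nonneg)
      also have "(\<Prod>i\<in>UNIV. s $ i * (1 / (R * s $ i))) = (\<Prod>i\<in>(UNIV::'a coord set). 1 / R)"
        by (intro prod.cong) (use pos in \<open>auto simp: less_imp_neq[symmetric]\<close>)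
      also have "\<dots> = (1 / R) ^ DIM('a)" by (simp add: CARD_coord)
      finally have pr: "(\<Prod>i\<in>UNIV. ennreal (s $ i)) * (\<Prod>i\<in>UNIV. ennreal (1 / (R * s $ i))) = ennreal ((1 / R) ^ DIM('a))" .
      have one: "ennreal (R ^ DIM('a)) * ennreal ((1 / R) ^ DIM('a)) = 1"
        using R by (simp add: ennreal_mult[symmetric] flip: power_mult_distrib)
      have "ennreal (R ^ DIM('a)) * (g s * indicator {s. \<forall>i. 0 < s $ i} s * (\<Prod>i\<in>UNIV. ennreal (1 / (R * s $ i))))
        = ennreal c * emeasure lborel (polar_at P (chart s)) * (ennreal (R ^ DIM('a)) * ((\<Prod>i\<in>UNIV. ennreal (s $ i)) * (\<Prod>i\<in>UNIV. ennreal (1 / (R * s $ i)))))"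
        using True pos by (simp add: g_def mult_ac)
      also have "\<dots> = ennreal c * ?f (chart s)" using True by (simp only: pr one) simp
      finally show ?thesis by simp
    qed
  qed
  also have "\<dots> = ennreal (R ^ DIM('a)) * (\<integral>\<^sup>+s. g s * indicator {s. \<forall>i. 0 < s $ i} s * (\<Prod>i\<in>UNIV. ennreal (1 / (R * s $ i))) \<partial>lborel)"
    by (rule nn_integral_cmult) measurable
  also have "\<dots> = ennreal (R ^ DIM('a)) * (\<integral>\<^sup>+t. g (?e t) \<partial>lborel)"
    by (subst nn_integral_exp_coords[OF R]) auto
  also have "(\<integral>\<^sup>+t. g (?e t) \<partial>lborel) = (\<integral>\<^sup>+t. indicator increasing_simplex t * emeasure lborel (dual_body (?e t)) \<partial>lborel)"
  proof (rule nn_integral_cong)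
    fix t :: "real^'a coord"
    have "?e t \<in> ?D \<longleftrightarrow> t \<in> increasing_simplex"
      using R by (auto simp: decreasing_simplex_def increasing_simplex_def zero_le_mult_iff)
    then show "g (?e t) = indicator increasing_simplex t * emeasure lborel (dual_body (?e t))"
      using c(3)[of "?e t"] by (auto simp: g_def indicator_def simp del: mult_minus_left)
  qed
  finally show ?thesis .
qed

text \<open>
  Coordinates that are bounded below and have a sum of at most \<open>1\<close> are also bounded above.
\<close>

lemma dual_body_dominated:
  obtains K where "emeasure lborel K < \<infinity>" "K \<in> sets borel" "\<And>s. s \<in> decreasing_simplex \<Longrightarrow> dual_body s \<subseteq> K"
proof -
  obtain C where C: "\<And>s \<eta> i. s \<in> decreasing_simplex \<Longrightarrow> \<eta> \<in> dual_body s \<Longrightarrow> - C \<le> \<eta> $ i"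
    by (rule dual_body_bounded) blast
  define K :: "(real^'a coord) set" where "K = cbox (\<chi> i. - C) (\<chi> i. 1 + \<bar>C\<bar> * DIM('a))"
  show thesis
  proof
    show "emeasure lborel K < \<infinity>" unfolding K_def by (rule emeasure_compact_finite) (rule compact_cbox)
    show "K \<in> sets borel" by (simp add: K_def)
    fix s :: "real^'a coord" assume s: "s \<in> decreasing_simplex"
    have "\<eta> $ i \<le> 1 + \<bar>C\<bar> * DIM('a)" if \<eta>: "\<eta> \<in> dual_body s" for \<eta> i
    proof -
      have "\<eta> $ i \<le> \<eta> $ i + (\<Sum>j\<in>UNIV - {i}. \<eta> $ j + \<bar>C\<bar>)"
        using C[OF s \<eta>] by (simp add: sum_nonneg add_increasing2) (smt (verit) sum_nonneg)
      also have "\<dots> = (\<Sum>j\<in>UNIV. \<eta> $ j) + (\<Sum>j\<in>UNIV - {i}. \<bar>C\<bar>)"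
        by (simp add: sum.distrib sum.remove[of UNIV i])
      also have "\<dots> \<le> 1 + (\<Sum>j\<in>(UNIV :: 'a coord set). \<bar>C\<bar>)"
        using dual_body_sum[OF \<eta>] by (intro add_mono sum_mono2) auto
      finally show ?thesis by (simp add: CARD_coord mult.commute)
    qed
    then show "dual_body s \<subseteq> K" using C[OF s] by (auto simp: K_def mem_box_cart)
  qed
qed

text \<open>
  The excluded coordinate hyperplanes form a null set. Away from them, membership in the dual body is
  eventually decided by the two one-sided estimates, because the scales separate.
\<close>

lemma eventually_dual_body_iff:
  assumes t: "t \<in> increasing_simplex" "\<And>i. 0 < t $ i" "\<And>i j. i < j \<Longrightarrow> t $ i < t $ j"
    and X: "filterlim X at_top sequentially" "\<And>k. 0 < X k"
    and \<eta>: "\<And>i. \<eta> $ i \<noteq> 0"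
  shows "\<forall>\<^sub>F k in sequentially. \<eta> \<in> dual_body (\<chi> i. exp (- X k * t $ i)) \<longleftrightarrow>
    \<eta> \<in> {x. (\<forall>i. 0 \<le> x $ i) \<and> (\<Sum>i\<in>UNIV. x $ i) \<le> 1}"
proof -
  let ?s = "\<lambda>k. \<chi> i. exp (- X k * t $ i)"
  have in_simplex: "?s k \<in> decreasing_simplex" for k using exp_in_decreasing_simplex[OF t(1)] X(2) by (simp add: less_imp_le)
  have pairs: "\<forall>\<^sub>F k in sequentially. \<forall>i j. j < i \<longrightarrow> B j i * exp (- X k * t $ i) \<le> exp (- X k * t $ j)"
    for B :: "'a coord \<Rightarrow> 'a coord \<Rightarrow> real"
  proof (intro eventually_all_finite)
    fix i j
    show "\<forall>\<^sub>F k in sequentially. j < i \<longrightarrow> B j i * exp (- X k * t $ i) \<le> exp (- X k * t $ j)"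
      using eventually_exp_dominated[OF X(1) t(3)] by (cases "j < i") auto
  qed
  have singles: "\<forall>\<^sub>F k in sequentially. B * exp (- X k * t $ i) \<le> 1" for B i
    using eventually_exp_dominated[OF X(1) t(2), of B i] by simp
  consider "(\<Sum>i\<in>UNIV. \<eta> $ i) > 1" | i where "\<eta> $ i < 0" | "\<forall>i. \<eta> $ i > 0" "(\<Sum>i\<in>UNIV. \<eta> $ i) \<le> 1"
    using \<eta> by (metis linorder_neqE_linordered_idom not_le)
  then show ?thesis
  proof cases
    case 1
    then have "\<eta> \<notin> dual_body s" for s using dual_body_sum[of \<eta> s] by auto
    with 1 show ?thesis by simp
  next
    case (2 i)
    \<comment> \<open>Any \<open>M\<close> with \<open>- M \<eta>\<^sub>i > 1\<close> contradicts the upper estimate.\<close>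
    define M where "M = 2 / - (\<eta> $ i)"
    have M: "M > 0" "- (M * \<eta> $ i) = 2" using 2 by (simp_all add: M_def field_simps)
    show ?thesis using singles[of "1 + M" i] pairs[of "\<lambda>_ _. 1 + M"]
    proof eventually_elim
      case (elim k)
      have "\<not> - (M * \<eta> $ i) \<le> 1" using M(2) by simp
      then have "\<eta> \<notin> dual_body (?s k)"
        using dual_body_upper[OF in_simplex, of \<eta> k M i] M(1) elim by (auto simp: less_imp_le)
      then show ?case using 2 by (auto simp: not_le intro!: exI[of _ i])
    qed
  next
    case 3
    obtain a where a: "\<And>i y. y \<in> P \<Longrightarrow> 0 \<le> a i \<bullet> (y - p 0)" "\<And>i j. j < i \<Longrightarrow> a i \<bullet> edge j = 0" "\<And>i. a i \<bullet> edge i = 1"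
      by (rule supportE) blast
    define \<theta> where "\<theta> = Min (range (\<lambda>i. \<eta> $ i))"
    have \<theta>: "\<theta> > 0" "\<theta> \<le> \<eta> $ i" for i using 3 by (auto simp: \<theta>_def)
    show ?thesis using pairs[of "\<lambda>j i. \<bar>a j \<bullet> edge i\<bar> * 2 / \<theta>"]
    proof eventually_elim
      case (elim k)
      have "\<eta> \<in> dual_body (?s k)"
      proof (rule dual_body_lower[OF _ \<theta>(2) 3(2) \<theta>(1) _ a])
        show "\<bar>a j \<bullet> edge i\<bar> * ?s k $ i \<le> \<theta> / 2 * ?s k $ j" if "j < i" for i j
          using elim that \<theta>(1) by (auto simp: field_simps)
      qed auto
      then show ?case using 3 by (auto simp: less_imp_le)
    qed
  qed
qed

lemma dual_body_volume_tendsto: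
  assumes t: "t \<in> increasing_simplex" "\<And>i. 0 < t $ i" "\<And>i j. i < j \<Longrightarrow> t $ i < t $ j"
    and X: "filterlim X at_top sequentially" "\<And>k. 0 < X k"
  shows "(\<lambda>k. emeasure lborel (dual_body (\<chi> i. exp (- X k * t $ i)))) \<longlonglongrightarrow> ennreal (1 / fact DIM('a))"
proof -
  let ?s = "\<lambda>k. \<chi> i. exp (- X k * t $ i)"
  let ?S = "{x :: real^'a coord. (\<forall>i. 0 \<le> x $ i) \<and> (\<Sum>i\<in>UNIV. x $ i) \<le> 1}"
  obtain K where K: "emeasure lborel K < \<infinity>" "K \<in> sets borel" "\<And>s. s \<in> decreasing_simplex \<Longrightarrow> dual_body s \<subseteq> K"
    by (rule dual_body_dominated) blast
  have bor: "dual_body (?s k) \<in> sets borel" for k by (rule dual_body_volume) simp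
  have S: "?S \<in> sets borel"
    by (auto intro!: borel_closed closed_Collect_conj closed_Collect_all closed_Collect_le continuous_intros)
  have "(\<lambda>k. \<integral>\<^sup>+\<eta>. indicator (dual_body (?s k)) \<eta> \<partial>lborel) \<longlonglongrightarrow> (\<integral>\<^sup>+\<eta>. indicator ?S \<eta> \<partial>lborel)"
  proof (rule nn_integral_dominated_convergence[where w = "indicator K"])
    show "(\<integral>\<^sup>+\<eta>. indicator K \<eta> \<partial>lborel) < \<infinity>" using K by simp
    have "?s k \<in> decreasing_simplex" for k using exp_in_decreasing_simplex[OF t(1)] X(2) by (simp add: less_imp_le)
    then show "AE \<eta> in lborel. indicator (dual_body (?s k)) \<eta> \<le> (indicator K \<eta> :: ennreal)" for k
      using K(3)[of "?s k"] by (intro AE_I2) (auto simp: indicator_def)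
    have "AE \<eta> in lborel. \<forall>i\<in>UNIV. axis i 1 \<bullet> (\<eta> :: real^'a coord) \<noteq> 0"
      by (intro AE_finite_allI AE_lborel_hyperplane) (auto simp: axis_eq_0_iff)
    then show "AE \<eta> in lborel. (\<lambda>k. indicator (dual_body (?s k)) \<eta>) \<longlonglongrightarrow> (indicator ?S \<eta> :: ennreal)"
    proof eventually_elim
      case (elim \<eta>)
      then have "\<eta> $ i \<noteq> 0" for i by (simp add: inner_axis')
      from eventually_dual_body_iff[OF t X this]
      show ?case by (intro tendsto_eventually) (auto elim!: eventually_mono simp: indicator_def)
    qed
  qed (use bor S K(2) in auto)
  then show ?thesis
    using bor S emeasure_std_simplex_vec[where 'm="'a coord"] by (simp add: CARD_coord)
qed

lemma flag_simplex_integral_tendsto: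
  assumes X: "filterlim X at_top sequentially" "\<And>k. 0 < X k"
  shows "(\<lambda>k. ennreal (1 / X k ^ DIM('a)) * (\<integral>\<^sup>+x. emeasure lborel (polar_at P x) *
       indicator (chart ` {s\<in>decreasing_simplex. \<forall>i. exp (- X k) \<le> s $ i}) x \<partial>lborel)) \<longlonglongrightarrow> ennreal (1 / (fact DIM('a))\<^sup>2)"
proof -
  let ?e = "\<lambda>k t. (\<chi> i. exp (- X k * t $ i)) :: real^'a coord"
  let ?u = "\<lambda>k t. indicator increasing_simplex t * emeasure lborel (dual_body (?e k t))"
  obtain K where K: "emeasure lborel K < \<infinity>" "K \<in> sets borel" "\<And>s. s \<in> decreasing_simplex \<Longrightarrow> dual_body s \<subseteq> K"
    by (rule dual_body_dominated) blast
  obtain c where c: "\<And>s. (\<And>i. 0 < s $ i) \<Longrightarrow> emeasure lborel (dual_body s)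
        = ennreal c * emeasure lborel (polar_at P (chart s)) * (\<Prod>i\<in>UNIV. ennreal (s $ i))"
    by (rule dual_body_volume) blast
  have vol: "emeasure lborel (increasing_simplex :: (real^'a coord) set) = ennreal (1 / fact DIM('a))"
    using emeasure_increasing_simplex[where 'm="'a coord"] by (simp add: CARD_coord)
  have "closed (increasing_simplex :: (real^'a coord) set)" unfolding increasing_simplex_def
    by (auto intro!: closed_Collect_conj closed_Collect_all closed_Collect_imp closed_Collect_le continuous_intros)
  then have [measurable]: "(increasing_simplex :: (real^'a coord) set) \<in> sets borel" by simp
  have u: "?u k \<in> borel_measurable borel" for k
  proof -
    have "(\<lambda>t. chart (?e k t)) \<in> borel \<rightarrow>\<^sub>M borel" by measurable
    note [measurable] = measurable_compose[OF this measurable_polar_volume]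
    show ?thesis by (subst c) (simp, simp only: vec_lambda_beta, measurable)
  qed
  have "(\<lambda>k. \<integral>\<^sup>+t. ?u k t \<partial>lborel) \<longlonglongrightarrow> (\<integral>\<^sup>+(t :: real^'a coord). indicator increasing_simplex t * ennreal (1 / fact DIM('a)) \<partial>lborel)"
  proof (rule nn_integral_dominated_convergence[where w = "\<lambda>(t :: real^'a coord). indicator increasing_simplex t * emeasure lborel K"])
    show "?u k \<in> borel_measurable lborel" for k using u by simp
    show "(\<integral>\<^sup>+(t :: real^'a coord). indicator increasing_simplex t * emeasure lborel K \<partial>lborel) < \<infinity>"
      using K(1) vol by (simp add: nn_integral_multc ennreal_mult_less_top)
    show "AE t in lborel. ?u k t \<le> indicator increasing_simplex t * emeasure lborel K" for k
      using K(2,3) exp_in_decreasing_simplex[of _ "X k"] X(2)[of k]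
      by (intro AE_I2) (auto simp: indicator_def less_imp_le intro!: emeasure_mono)
    have "AE t in lborel. \<forall>i\<in>UNIV. axis i 1 \<bullet> (t :: real^'a coord) \<noteq> 0"
      by (intro AE_finite_allI AE_lborel_hyperplane) (auto simp: axis_eq_0_iff)
    moreover have "AE t in lborel. \<forall>i\<in>UNIV. \<forall>j\<in>{j. j \<noteq> i}. (axis i 1 - axis j 1) \<bullet> (t :: real^'a coord) \<noteq> 0"
      by (intro AE_finite_allI AE_lborel_hyperplane) (auto simp: axis_eq_axis)
    ultimately show "AE t in lborel. (\<lambda>k. ?u k t) \<longlonglongrightarrow> indicator increasing_simplex t * ennreal (1 / fact DIM('a))"
    proof eventually_elim
      case (elim t)
      then have ne: "t $ i \<noteq> 0" "j \<noteq> i \<Longrightarrow> t $ i \<noteq> t $ j" for i j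
        by (simp_all add: inner_axis' inner_diff_left)
      show ?case
      proof (cases "t \<in> increasing_simplex")
        case True
        then have "0 < t $ i" "i < j \<Longrightarrow> t $ i < t $ j" for i j
          using ne by (auto simp: increasing_simplex_def order_less_le)
        from dual_body_volume_tendsto[OF True this X] True show ?thesis by simp
      qed simp
    qed
  qed auto
  also have "(\<integral>\<^sup>+(t :: real^'a coord). indicator increasing_simplex t * ennreal (1 / fact DIM('a)) \<partial>lborel) = ennreal (1 / (fact DIM('a))\<^sup>2)"
    by (simp add: nn_integral_multc vol power2_eq_square ennreal_mult[symmetric])
  finally have lim: "(\<lambda>k. \<integral>\<^sup>+t. ?u k t \<partial>lborel) \<longlonglongrightarrow> ennreal (1 / (fact DIM('a))\<^sup>2)" .
  have "ennreal (1 / X k ^ DIM('a)) * ennreal (X k ^ DIM('a)) = 1" for k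
    using X(2)[of k] by (simp add: ennreal_mult[symmetric])
  with lim show ?thesis by (simp add: nn_integral_chart[OF X(2)] mult.assoc[symmetric])
qed

end

section \<open>From flags to charts\<close>

lemma eventually_rel_interior_bump:
  fixes S :: "'a::euclidean_space set"
  assumes "x \<in> rel_interior S" "u \<in> S" "v \<in> S"
  shows "\<forall>\<^sub>F c in at_right 0. x + c *\<^sub>R (u - v) \<in> S"
proof -
  obtain e where e: "e > 0" "cball x e \<inter> affine hull S \<subseteq> S" and x: "x \<in> S"
    using assms(1) by (auto simp: mem_rel_interior_cball)
  have aff: "x + c *\<^sub>R (u - v) \<in> affine hull S" for c
    using x assms(2,3) by (intro mem_affine_3_minus affine_affine_hull hull_inc)
  have "((\<lambda>c. c * norm (u - v)) \<longlongrightarrow> 0 * norm (u - v)) (at_right 0)" by (intro tendsto_intros)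
  then have "\<forall>\<^sub>F c in at_right 0. c * norm (u - v) < e" using e(1) by (auto dest: order_tendstoD(2))
  then show ?thesis using eventually_at_right_less[of 0]
  proof eventually_elim
    case (elim c)
    then have "x + c *\<^sub>R (u - v) \<in> cball x e" by (simp add: dist_norm)
    then show ?case using aff e(2) by blast
  qed
qed

lemma flag_nth:
  assumes "fs \<in> flags P" "aff_dim P = int d" "k \<le> d"
  shows "fs ! k face_of P" "aff_dim (fs ! k) = int k" "fs ! k \<noteq> {}"
proof -
  show "fs ! k face_of P" and *: "aff_dim (fs ! k) = int k"
    using assms flags_length[OF assms(1,2)] by (auto simp: flags_def)
  show "fs ! k \<noteq> {}" using * by auto
qed

text \<open>
  Faces of a polytope are exposed, so every face of the flag has a supporting hyperplane that meets \<open>P\<close> in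
  exactly this face. It misses the next point \<open>q (fs ! Suc i)\<close>, which is in the relative interior of
  a strictly larger face; dividing by the slack there gives the normalisation.
\<close>

lemma flag_frame_flag:
  fixes P :: "'a::euclidean_space set"
  assumes P: "polytope P" "aff_dim P = int DIM('a)" and fs: "fs \<in> flags P"
    and q: "\<And>F. F face_of P \<Longrightarrow> F \<noteq> {} \<Longrightarrow> q F \<in> rel_interior F"
  shows "flag_frame P (\<lambda>k. q (fs ! k))"
proof
  let ?n = "DIM('a)"
  note nth = flag_nth[OF fs P(2)]
  have len: "length fs = Suc ?n" using flags_length[OF fs P(2)] .
  have qr: "q (fs ! k) \<in> rel_interior (fs ! k)" if "k \<le> ?n" for k using q nth that by blast
  have qin: "q (fs ! j) \<in> fs ! k" if "j \<le> k" "k \<le> ?n" for j k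
    using qr[of j] rel_interior_subset[of "fs ! j"] flags_mono[OF fs that(1)] len that by auto
  have sub: "fs ! k \<subseteq> P" if "k \<le> ?n" for k using nth(1)[OF that] face_of_imp_subset by blast
  show "convex P" using P(1) by (rule polytope_imp_convex)
  show "q (fs ! k) \<in> P" if "k \<le> ?n" for k using qin[OF order_refl that] sub[OF that] by blast
  have "\<forall>\<^sub>F c in at_right 0. \<forall>i\<in>{..<?n}. \<forall>k\<in>{i<..?n}. q (fs ! k) + c *\<^sub>R (q (fs ! Suc i) - q (fs ! i)) \<in> P"
  proof (intro eventually_ball_finite ballI finite_lessThan finite_greaterThanAtMost)
    fix i k assume *: "i \<in> {..<?n}" "k \<in> {i<..?n}"
    show "\<forall>\<^sub>F c in at_right 0. q (fs ! k) + c *\<^sub>R (q (fs ! Suc i) - q (fs ! i)) \<in> P"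
      using eventually_rel_interior_bump[OF qr[of k] qin[of "Suc i" k] qin[of i k]] *
      by (auto elim!: eventually_mono dest: subsetD[OF sub, rotated])
  qed
  then have "\<forall>\<^sub>F c in at_right (0::real). 0 < c \<and> (\<forall>i\<in>{..<?n}. \<forall>k\<in>{i<..?n}. q (fs ! k) + c *\<^sub>R (q (fs ! Suc i) - q (fs ! i)) \<in> P)"
    using eventually_at_right_less[of 0] by eventually_elim simp
  from eventually_happens[OF this]
  show "\<exists>c>0. \<forall>i<?n. \<forall>k\<in>{i<..?n}. q (fs ! k) + c *\<^sub>R (q (fs ! Suc i) - q (fs ! i)) \<in> P" by auto
  fix i assume i: "i < ?n"
  have "fs ! i exposed_face_of P"
    using exposed_face_of_polyhedron[OF polytope_imp_polyhedron[OF P(1)]] nth(1) i by simp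
  then obtain a b where ab: "P \<subseteq> {x. a \<bullet> x \<le> b}" "fs ! i = P \<inter> {x. a \<bullet> x = b}"
    by (auto simp: exposed_face_of_def)
  have "q (fs ! Suc i) \<notin> fs ! i"
  proof
    assume "q (fs ! Suc i) \<in> fs ! i"
    then have "fs ! Suc i \<subseteq> fs ! i"
      using subset_of_face_of[OF nth(1)[of i] sub[of "Suc i"]] qr[of "Suc i"] i by (auto simp: disjnt_def)
    then have "aff_dim (fs ! Suc i) \<le> aff_dim (fs ! i)" by (rule aff_dim_subset)
    then show False using nth(2)[of i] nth(2)[of "Suc i"] i by simp
  qed
  then have \<delta>: "b - a \<bullet> q (fs ! Suc i) > 0" (is "?\<delta> > 0")
    using ab qin[of "Suc i" "Suc i"] sub[of "Suc i"] i by (force simp: order_less_le)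
  have on: "a \<bullet> q (fs ! j) = b" if "j \<le> i" for j using qin[of j i] that i ab(2) by simp
  show "\<exists>a. (\<forall>y\<in>P. 0 \<le> a \<bullet> (y - q (fs ! 0))) \<and> (\<forall>j<i. a \<bullet> (q (fs ! Suc j) - q (fs ! j)) = 0)
      \<and> a \<bullet> (q (fs ! Suc i) - q (fs ! i)) = 1"
  proof (intro exI[of _ "- (1 / ?\<delta>) *\<^sub>R a"] conjI ballI allI impI)
    show "0 \<le> (- (1 / ?\<delta>) *\<^sub>R a) \<bullet> (y - q (fs ! 0))" if "y \<in> P" for y
      using ab(1) that \<delta> on[of 0] by (auto simp: inner_diff_right divide_simps)
    show "(- (1 / ?\<delta>) *\<^sub>R a) \<bullet> (q (fs ! Suc j) - q (fs ! j)) = 0" if "j < i" for j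
      using on[of j] on[of "Suc j"] that by (simp add: inner_diff_right)
    show "(- (1 / ?\<delta>) *\<^sub>R a) \<bullet> (q (fs ! Suc i) - q (fs ! i)) = 1"
    proof -
      have "a \<bullet> (q (fs ! Suc i) - q (fs ! i)) = - ?\<delta>" using on[of i] by (simp add: inner_diff_right)
      then show ?thesis using \<delta> by (auto simp: divide_eq_eq)
    qed
  qed
qed

lemma negligible_affine_hull_few:
  fixes S :: "'a::euclidean_space set"
  assumes "finite S" "card S \<le> DIM('a)"
  shows "negligible (affine hull S)"
proof -
  have "aff_dim (affine hull S) < int DIM('a)"
    using aff_dim_le_card[OF assms(1)] assms(2) by simp
  then have "interior (affine hull S) = {}" using aff_dim_nonempty_interior by fastforce
  then show ?thesis using negligible_convex_interior affine_imp_convex affine_affine_hull by blast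
qed

section \<open>Summation over the flags\<close>

text \<open>
  The truncated flag simplices cover the ball and overlap in a null set, so the integral is the sum of
  the contributions of the flags.
\<close>

lemma funk_volume_tendsto:
  fixes P :: "'a::euclidean_space set"
  assumes P: "polytope P" "aff_dim P = int DIM('a)" and P0: "0 \<in> interior P"
  shows "((\<lambda>R. ennreal (1 / R ^ DIM('a)) * (\<integral>\<^sup>+x\<in>funk_ball P 0 R. emeasure lborel (polar_at P x) \<partial>lborel))
     \<longlongrightarrow> ennreal (real (card (flags P)) / (fact DIM('a))\<^sup>2)) at_top"
proof (rule tendsto_at_topI_sequentially)
  fix X :: "nat \<Rightarrow> real" assume X: "filterlim X at_top sequentially"
  let ?n = "DIM('a)"
  \<comment> \<open>For \<open>P\<close> itself the choice must be the origin, the centre of the dilation that defines the ball.\<close>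
  define q where "q F = (if F = P then 0 else SOME x. x \<in> rel_interior F)" for F
  have q: "q F \<in> rel_interior F" if "F face_of P" "F \<noteq> {}" for F
  proof (cases "F = P")
    case True
    then show ?thesis using P0 interior_subset_rel_interior[of P] by (auto simp: q_def)
  next
    case False
    have "convex F" using that(1) by (rule face_of_imp_convex)
    then show ?thesis using False that(2) rel_interior_eq_empty[of F] some_in_eq[of "rel_interior F"] by (simp add: q_def)
  qed
  let ?p = "\<lambda>fs k. q (fs ! k)"
  have frame: "flag_frame P (?p fs)" if "fs \<in> flags P" for fs using flag_frame_flag[OF P that q] .
  have pn: "?p fs ?n = 0" if "fs \<in> flags P" for fs
  proof -
    have "length fs = Suc ?n" using flags_length[OF that P(2)] .
    then have "fs ! ?n = P" using last_flag[OF P(1) that] by (metis last_conv_nth diff_Suc_1 list.size(3) old.nat.distinct(2))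
    then show ?thesis by (simp add: q_def)
  qed
  define A where "A fs R = flag_frame.chart (?p fs) ` {s\<in>decreasing_simplex. \<forall>i. exp (- R) \<le> s $ i}" for fs :: "'a set list" and R
  have A: "x \<in> A fs R \<longleftrightarrow> (\<exists>l. (\<forall>k. 0 \<le> l k) \<and> (\<Sum>k\<le>?n. l k) = 1 \<and> exp (- R) \<le> l ?n \<and> x = (\<Sum>k\<le>?n. l k *\<^sub>R ?p fs k))"
    if "fs \<in> flags P" for fs R x
    unfolding A_def by (rule flag_frame.chart_region[OF frame[OF that]])
  have A_meas: "A fs R \<in> sets borel" if "fs \<in> flags P" for fs R
    unfolding A_def using flag_frame.closed_chart_region[OF frame[OF that]] by (rule borel_closed)
  have cover: "funk_ball P 0 R = (\<Union>fs\<in>flags P. A fs R)" if R: "R > 0" for R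
  proof (intro equalityI subsetI)
    define \<epsilon> where "\<epsilon> = exp (- R)"
    have \<epsilon>: "0 < \<epsilon>" "\<epsilon> < 1" using R by (auto simp: \<epsilon>_def)
    have split: "(\<Sum>k\<le>?n. f k) = (\<Sum>k<?n. f k) + f ?n" for f :: "nat \<Rightarrow> 'b::comm_monoid_add"
      by (simp add: lessThan_Suc_atMost[symmetric])
    {
      fix x assume "x \<in> funk_ball P 0 R"
      then obtain z where z: "z \<in> P" "x = (1 - \<epsilon>) *\<^sub>R z" by (auto simp: funk_ball_def \<epsilon>_def)
      obtain fs l where fs: "fs \<in> flags P" and l: "\<forall>k. 0 \<le> l k" "(\<Sum>k\<le>?n. l k) = 1" "z = (\<Sum>k\<le>?n. l k *\<^sub>R ?p fs k)"
        using flag_simplices_cover[OF P z(1) q] by metis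
      \<comment> \<open>Shrinking towards \<open>p\<^sub>n = 0\<close> transfers the weight \<open>\<epsilon>\<close> to the last vertex.\<close>
      define m where "m k = (1 - \<epsilon>) * l k + (if k = ?n then \<epsilon> else 0)" for k
      have "\<forall>k. 0 \<le> m k" using l(1) \<epsilon> by (auto simp: m_def)
      moreover have "(\<Sum>k\<le>?n. m k) = 1" using l(2) by (simp add: m_def sum.distrib flip: sum_distrib_left)
      moreover have "\<epsilon> \<le> m ?n" using l(1) \<epsilon> by (simp add: m_def)
      moreover have "x = (\<Sum>k\<le>?n. m k *\<^sub>R ?p fs k)"
        using l(3) z(2) pn[OF fs] by (simp add: m_def split scaleR_sum_right)
      ultimately have "x \<in> A fs R" unfolding A[OF fs] \<epsilon>_def by blast
      with fs show "x \<in> (\<Union>fs\<in>flags P. A fs R)" by (rule UN_I)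
    next
      fix x assume "x \<in> (\<Union>fs\<in>flags P. A fs R)"
      then obtain fs l where fs: "fs \<in> flags P" and l: "\<forall>k. 0 \<le> l k" "(\<Sum>k\<le>?n. l k) = 1" "\<epsilon> \<le> l ?n" "x = (\<Sum>k\<le>?n. l k *\<^sub>R ?p fs k)"
        unfolding \<epsilon>_def by (elim UN_E) (unfold A, blast)
      define m where "m k = (l k - (if k = ?n then \<epsilon> else 0)) / (1 - \<epsilon>)" for k
      have "(\<Sum>k\<le>?n. m k *\<^sub>R ?p fs k) \<in> P"
      proof (rule convex_sum)
        show "(\<Sum>k\<le>?n. m k) = 1" using l(2) \<epsilon> by (simp add: m_def sum_subtractf flip: sum_divide_distrib)
      qed (use l \<epsilon> flag_frame.convex[OF frame[OF fs]] flag_frame.in_P[OF frame[OF fs]] in \<open>auto simp: m_def\<close>)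
      moreover have "x = (1 - \<epsilon>) *\<^sub>R (\<Sum>k\<le>?n. m k *\<^sub>R ?p fs k)"
        using \<epsilon> l(4) pn[OF fs] by (simp add: m_def split scaleR_sum_right)
      ultimately show "x \<in> funk_ball P 0 R" by (auto simp: funk_ball_def \<epsilon>_def)
    }
  qed
  \<comment> \<open>Points with a vanishing weight with respect to some flag: they lie in finitely many proper affine subspaces.\<close>
  define N where "N = (\<Union>fs\<in>flags P. \<Union>k\<le>?n. affine hull (?p fs ` ({..?n} - {k})))"
  have fin: "finite (flags P)" using finite_flags[OF P(1)] .
  have "negligible (affine hull (?p fs ` ({..?n} - {k})))" if "k \<le> ?n" for fs k
  proof (rule negligible_affine_hull_few)
    have "card ({..?n} - {k}) = ?n" using that by simp
    then show "card (?p fs ` ({..?n} - {k})) \<le> ?n" using card_image_le[of "{..?n} - {k}" "?p fs"] by simp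
  qed simp
  then have "negligible N" unfolding N_def using fin by (intro negligible_Union) (auto intro!: negligible_Union)
  then have AE_N: "AE x in lborel. x \<notin> N"
    by (metis AE_completion_iff AE_not_in negligible_iff_null_sets)
  have pos: "0 < l k" if "x \<notin> N" "fs \<in> flags P" "\<forall>k. 0 \<le> l k" "(\<Sum>k\<le>?n. l k) = 1" "x = (\<Sum>k\<le>?n. l k *\<^sub>R ?p fs k)" "k \<le> ?n"
    for x fs l k
  proof (rule ccontr)
    assume "\<not> 0 < l k"
    then have 0: "l k = 0" using that(3) by (simp add: order_less_le)
    then have s1: "(\<Sum>j\<in>{..?n} - {k}. l j) = 1" and s2: "x = (\<Sum>j\<in>{..?n} - {k}. l j *\<^sub>R ?p fs j)"
      using that by (simp_all add: sum.remove[of "{..?n}" k])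
    have "x \<in> convex hull (?p fs ` ({..?n} - {k}))" unfolding s2
      by (rule convex_sum) (use s1 that(3) in \<open>auto intro: hull_inc\<close>)
    then have "x \<in> N" using convex_hull_subset_affine_hull that(2,6) by (fastforce simp: N_def)
    with that(1) show False ..
  qed
  have unique: "fs = gs" if asm: "x \<notin> N" "fs \<in> flags P" "gs \<in> flags P" "x \<in> A fs R" "x \<in> A gs R" for x fs gs R
  proof -
    obtain l where l: "\<forall>k. 0 \<le> l k" "(\<Sum>k\<le>?n. l k) = 1" "x = (\<Sum>k\<le>?n. l k *\<^sub>R ?p fs k)"
      using asm(4) A[OF asm(2)] by blast
    obtain m where m: "\<forall>k. 0 \<le> m k" "(\<Sum>k\<le>?n. m k) = 1" "x = (\<Sum>k\<le>?n. m k *\<^sub>R ?p gs k)"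
      using asm(5) A[OF asm(3)] by blast
    show ?thesis
      by (rule flag_simplices_disjoint[OF P asm(2,3) q pos[OF asm(1,2) l] l(2) _ m(2)]) (use l m in auto)
  qed
  have decomp: "(\<integral>\<^sup>+x\<in>funk_ball P 0 R. emeasure lborel (polar_at P x) \<partial>lborel)
      = (\<Sum>fs\<in>flags P. \<integral>\<^sup>+x. emeasure lborel (polar_at P x) * indicator (A fs R) x \<partial>lborel)" if "R > 0" for R
  proof -
    have "(\<integral>\<^sup>+x\<in>funk_ball P 0 R. emeasure lborel (polar_at P x) \<partial>lborel)
      = (\<integral>\<^sup>+x. (\<Sum>fs\<in>flags P. emeasure lborel (polar_at P x) * indicator (A fs R) x) \<partial>lborel)"
    proof (rule nn_integral_cong_AE)
      show "AE x in lborel. emeasure lborel (polar_at P x) * indicator (funk_ball P 0 R) x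
         = (\<Sum>fs\<in>flags P. emeasure lborel (polar_at P x) * indicator (A fs R) x)"
        using AE_N
      proof eventually_elim
        case (elim x)
        have "indicator (funk_ball P 0 R) x = (\<Sum>fs\<in>flags P. indicator (A fs R) x :: ennreal)"
        proof (cases "x \<in> funk_ball P 0 R")
          case True
          then obtain fs where fs: "fs \<in> flags P" "x \<in> A fs R" unfolding cover[OF \<open>R > 0\<close>] by (elim UN_E)
          have "(\<Sum>gs\<in>flags P. indicator (A gs R) x :: ennreal) = (\<Sum>gs\<in>flags P. if gs = fs then 1 else 0)"
          proof (rule sum.cong)
            fix gs assume gs: "gs \<in> flags P"
            show "indicator (A gs R) x = (if gs = fs then 1 else 0 :: ennreal)"
            proof (cases "gs = fs")
              case False
              then have "x \<notin> A gs R" using unique[OF elim gs fs(1) _ fs(2)] by metis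
              with False show ?thesis by simp
            qed (use fs in simp)
          qed simp
          then show ?thesis using fs fin True by simp
        next
          case False
          then have "x \<notin> A fs R" if "fs \<in> flags P" for fs using that cover[OF \<open>R > 0\<close>] by simp
          then show ?thesis using False by (simp add: sum.neutral)
        qed
        then show ?case by (simp add: sum_distrib_left)
      qed
    qed
    also have "\<dots> = (\<Sum>fs\<in>flags P. \<integral>\<^sup>+x. emeasure lborel (polar_at P x) * indicator (A fs R) x \<partial>lborel)"
      by (intro nn_integral_sum borel_measurable_times_ennreal borel_measurable_indicator)
         (use A_meas measurable_polar_volume in auto)
    finally show ?thesis .
  qed
  \<comment> \<open>Positive radii are needed for every index; a finite part of the sequence does not matter.\<close>
  define Y where "Y k = max 1 (X k)" for k
  have Y: "0 < Y k" for k by (simp add: Y_def)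
  have XY: "\<forall>\<^sub>F k in sequentially. X k = Y k"
    using X unfolding filterlim_at_top by (auto simp: Y_def elim!: eventually_mono dest!: spec[of _ 1])
  have Ylim: "filterlim Y at_top sequentially"
    using X by (rule filterlim_at_top_mono) (simp add: Y_def)
  have "(\<lambda>k. \<Sum>fs\<in>flags P. ennreal (1 / Y k ^ ?n) * (\<integral>\<^sup>+x. emeasure lborel (polar_at P x) * indicator (A fs (Y k)) x \<partial>lborel))
     \<longlonglongrightarrow> (\<Sum>fs\<in>flags P. ennreal (1 / (fact ?n)\<^sup>2))"
    unfolding A_def using flag_frame.flag_simplex_integral_tendsto[OF frame Ylim Y] by (intro tendsto_sum) auto
  also have "(\<Sum>fs\<in>flags P. ennreal (1 / (fact ?n)\<^sup>2)) = ennreal (real (card (flags P)) / (fact ?n)\<^sup>2)"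
    by (simp add: ennreal_of_nat_eq_real_of_nat ennreal_mult[symmetric])
  finally have "(\<lambda>k. ennreal (1 / Y k ^ ?n) * (\<integral>\<^sup>+x\<in>funk_ball P 0 (Y k). emeasure lborel (polar_at P x) \<partial>lborel))
     \<longlonglongrightarrow> ennreal (real (card (flags P)) / (fact ?n)\<^sup>2)"
    by (simp add: decomp Y sum_distrib_left)
  then show "(\<lambda>k. ennreal (1 / X k ^ ?n) * (\<integral>\<^sup>+x\<in>funk_ball P 0 (X k). emeasure lborel (polar_at P x) \<partial>lborel))
     \<longlonglongrightarrow> ennreal (real (card (flags P)) / (fact ?n)\<^sup>2)"
    by (rule Lim_transform_eventually) (use XY in eventually_elim, simp)
qed

theorem theorem1p2:
  fixes P :: "(real ^ 'n) set"
  assumes "polytope P"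
    and "aff_dim P = int CARD('n)"
    and "0 \<in> interior P"
  shows "((\<lambda>R. ennreal (unit_ball_vol (real CARD('n)) / R ^ CARD('n)) *
               holmes_thompson_vol P (funk_ball P 0 R))
          \<longlongrightarrow> ennreal (real (card (flags P)) / (fact CARD('n))\<^sup>2)) at_top"
proof -
  let ?n = "CARD('n)" and ?\<omega> = "unit_ball_vol (real CARD('n))"
  have "((\<lambda>R. ennreal (1 / R ^ ?n) * (\<integral>\<^sup>+x\<in>funk_ball P 0 R. emeasure lborel (polar_at P x) \<partial>lborel))
     \<longlongrightarrow> ennreal (real (card (flags P)) / (fact ?n)\<^sup>2)) at_top"
    using funk_volume_tendsto[of P] assms by simp
  then show ?thesis
  proof (rule Lim_transform_eventually)
    show "\<forall>\<^sub>F R in at_top. ennreal (1 / R ^ ?n) * (\<integral>\<^sup>+x\<in>funk_ball P 0 R. emeasure lborel (polar_at P x) \<partial>lborel)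
       = ennreal (?\<omega> / R ^ ?n) * holmes_thompson_vol P (funk_ball P 0 R)"
      using eventually_gt_at_top[of 0]
    proof eventually_elim
      case (elim R)
      have \<omega>: "0 < ?\<omega>" "?\<omega> \<noteq> 0" using unit_ball_vol_pos[of "real ?n"] by linarith+
      have "ennreal (?\<omega> / R ^ ?n) * ennreal (1 / ?\<omega>) = ennreal (1 / R ^ ?n)"
        using elim \<omega> by (simp add: ennreal_mult[symmetric] del: unit_ball_vol_pos)
      then show ?case by (simp add: holmes_thompson_vol_def mult.assoc[symmetric])
    qed
  qed
qed

end
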